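(* There exist absolute constants $0<c<C$ such that for every $p=p(n)$ with $n^{-0.99}\le p\le 1-n^{-1}$, with probability tending to $1$ as $n\to\infty$ the minimum dimension $d$ such that $G=G(n,p)$ is a unit distance graph in $\mathbb{R}^d$ satisfies $$c\,\frac{n\log(1/(1-p))}{\log n}\le d\le C\,\frac{n\log(1/(1-p))}{\log n}.$$
   Context: A graph $G$ on $[n]$ is a unit distance graph in $\mathbb{R}^d$ if there are points $u_1,\dots,u_n\in\mathbb{R}^d$ (assigned to the vertices, not required to be distinct) such that $\|u_i-u_j\|_2=1$ for every pair of adjacent vertices $i,j$ (no condition is imposed on nonadjacent pairs). $G(n,p)$ denotes the binomial random graph on $[n]$ in which each pair is an edge independently with probability $p$. *)

theory Defs
  imports Complex_Main
begin

definition all_pairs :: "nat \<Rightarrow> nat set set" where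
  "all_pairs n = {e. \<exists>i j. i < n \<and> j < n \<and> i \<noteq> j \<and> e = {i, j}}"

definition gnp_prob :: "nat \<Rightarrow> real \<Rightarrow> (nat set set \<Rightarrow> bool) \<Rightarrow> real" where
  "gnp_prob n p P =
     (\<Sum>E\<in>Pow (all_pairs n).
        if P E then p ^ card E * (1 - p) ^ (card (all_pairs n) - card E) else 0)"

text \<open>A graph with edge set E is a unit distance graph in R^d: points u_i in R^d
  (coordinates indexed by k < d), not necessarily distinct, with Euclidean distance 1
  between adjacent vertices.\<close>
definition unit_distance_graph :: "nat \<Rightarrow> nat set set \<Rightarrow> bool" where
  "unit_distance_graph d E \<longleftrightarrow>
     (\<exists>u :: nat \<Rightarrow> nat \<Rightarrow> real. \<forall>i j. {i, j} \<in> E \<longrightarrow>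
        sqrt (\<Sum>k<d. (u i k - u j k)\<^sup>2) = 1)"

definition min_ud_dim :: "nat set set \<Rightarrow> nat" where
  "min_ud_dim E = (LEAST d. unit_distance_graph d E)"

end

theory Submission
  imports Defs "HOL-Library.Disjoint_Sets" "HOL-Library.FuncSet" "HOL-Real_Asymp.Real_Asymp"
    "Jordan_Normal_Form.Determinant"
begin

text \<open>Write q = 1 - p and L = ln (1 / q).

  Upper bound: the vertices of an m-colourable graph can be placed at the vertices of a simplex of
  side 1 in dimension m. Colour the vertices one after another. The new vertex fails to extend a
  colouring only if it has a neighbour in each of the m classes, and by independence and convexity this
  has probability at most exp (- m q^(n / m)), which is negligible for m = 400 n L / ln n.

  Lower bound: for a representation u in dimension d, the symmetric matrix with entries
  1 - |u i - u j|^2 has rank at most k = d + 2, unit diagonal, and vanishes on the edges. Following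
  Golovnev, Regev and Weinstein, pass to a principal submatrix on S minimizing the ratio of rank to size.
  If s is the number of its nonzero entries, then minimality gives s at least n |S| / k and a row basis
  with at most k s / n nonzero entries. Given the positions of these, the remaining zero pattern is that
  of |S|^2 polynomials in at most k s / n variables, so there are at most n^(7 k s / n) patterns. A
  given pattern is compatible with the random graph with probability at most q^((s - |S|) / 2), and for
  d below n L / (128 ln n) the union bound over all patterns succeeds.\<close>

section \<open>Random subsets and colourings\<close>

text \<open>Expectation over the random subset of \<open>A\<close> that contains each element
  independently with probability \<open>p\<close>. The weight is a product over \<open>A\<close>
  rather than powers of cardinalities so that it factors over disjoint unions.\<close>

definition rsub_expect :: "real \<Rightarrow> 'a set \<Rightarrow> ('a set \<Rightarrow> real) \<Rightarrow> real" where
  "rsub_expect p A f = (\<Sum>X\<in>Pow A. (\<Prod>a\<in>A. if a \<in> X then p else 1 - p) * f X)"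

lemma prod_if_mem_eq_powers:
  assumes "finite A" "X \<subseteq> A"
  shows "(\<Prod>a\<in>A. if a \<in> X then p else 1 - p) = p ^ card X * (1 - p :: real) ^ (card A - card X)"
proof -
  have "(\<Prod>a\<in>A. if a \<in> X then p else 1 - p) = (\<Prod>a\<in>A \<inter> X. p) * (\<Prod>a\<in>A \<inter> - X. 1 - p)"
    using assms(1) by (subst prod.If_cases) (auto simp: Collect_neg_eq)
  moreover have "A \<inter> X = X" "A \<inter> - X = A - X" using assms(2) by auto
  ultimately show ?thesis
    using assms finite_subset[of X A] by (simp add: card_Diff_subset)
qed

lemma finite_all_pairs [simp]: "finite (all_pairs n)"
proof -
  have "all_pairs n \<subseteq> Pow {..<n}" by (auto simp: all_pairs_def)
  then show ?thesis using finite_subset by blast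
qed

lemma doubleton_in_all_pairs: "{i, j} \<in> all_pairs n \<longleftrightarrow> i < n \<and> j < n \<and> i \<noteq> j"
proof
  assume "{i, j} \<in> all_pairs n"
  then obtain a b where "a < n" "b < n" "a \<noteq> b" "{i, j} = {a, b}" unfolding all_pairs_def by blast
  then show "i < n \<and> j < n \<and> i \<noteq> j" by (metis doubleton_eq_iff)
qed (unfold all_pairs_def, blast)

lemma gnp_prob_eq_expect:
  "gnp_prob n p P = rsub_expect p (all_pairs n) (\<lambda>E. of_bool (P E))"
  unfolding gnp_prob_def rsub_expect_def
  by (intro sum.cong refl) (auto simp: prod_if_mem_eq_powers)

text \<open>Independence in the form of Fubini's theorem: a subset of a disjoint union is a pair of
  subsets, and its weight is the product of their weights.\<close>

lemma rsub_expect_union: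
  assumes "finite A" "finite B" "A \<inter> B = {}"
  shows "rsub_expect p (A \<union> B) f = rsub_expect p A (\<lambda>X. rsub_expect p B (\<lambda>Y. f (X \<union> Y)))"
proof -
  let ?w = "\<lambda>A X. \<Prod>a\<in>A. if a \<in> X then p else 1 - p"
  have "rsub_expect p (A \<union> B) f = (\<Sum>(X, Y)\<in>Pow A \<times> Pow B. ?w (A \<union> B) (X \<union> Y) * f (X \<union> Y))"
    unfolding rsub_expect_def
  proof (rule sum.reindex_bij_witness[where j = "\<lambda>Z. (Z \<inter> A, Z \<inter> B)" and i = "\<lambda>(X, Y). X \<union> Y"])
    fix Z assume "Z \<in> Pow (A \<union> B)"
    then have "Z \<inter> A \<union> Z \<inter> B = Z" by blast
    then show "(case (Z \<inter> A, Z \<inter> B) of (X, Y) \<Rightarrow> X \<union> Y) = Z"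
      "(case (Z \<inter> A, Z \<inter> B) of (X, Y) \<Rightarrow> ?w (A \<union> B) (X \<union> Y) * f (X \<union> Y)) = ?w (A \<union> B) Z * f Z"
      by (simp_all only: prod.case)
  qed (use assms(3) in auto)
  also have "\<dots> = (\<Sum>(X, Y)\<in>Pow A \<times> Pow B. ?w A X * (?w B Y * f (X \<union> Y)))"
  proof (intro sum.cong refl, clarify)
    fix X Y assume "X \<subseteq> A" "Y \<subseteq> B"
    then have "?w (A \<union> B) (X \<union> Y) = ?w A X * ?w B Y"
      by (subst prod.union_disjoint)
        (use assms in \<open>auto intro!: arg_cong2[where f = "(*)"] prod.cong\<close>)
    then show "?w (A \<union> B) (X \<union> Y) * f (X \<union> Y) = ?w A X * (?w B Y * f (X \<union> Y))" by simp
  qed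
  also have "\<dots> = rsub_expect p A (\<lambda>X. rsub_expect p B (\<lambda>Y. f (X \<union> Y)))"
    unfolding rsub_expect_def by (simp add: sum.cartesian_product[symmetric] sum_distrib_left)
  finally show ?thesis .
qed

lemma rsub_expect_empty [simp]: "rsub_expect p {} f = f {}"
  by (simp add: rsub_expect_def)

lemma rsub_expect_singleton [simp]: "rsub_expect p {a} f = p * f {a} + (1 - p) * f {}"
  by (simp add: rsub_expect_def Pow_insert)

lemma rsub_expect_add: "rsub_expect p A (\<lambda>X. f X + g X) = rsub_expect p A f + rsub_expect p A g"
  by (simp add: rsub_expect_def distrib_left sum.distrib)

lemma rsub_expect_diff: "rsub_expect p A (\<lambda>X. f X - g X) = rsub_expect p A f - rsub_expect p A g"
  by (simp add: rsub_expect_def right_diff_distrib sum_subtractf)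

lemma rsub_expect_cmult: "rsub_expect p A (\<lambda>X. c * f X) = c * rsub_expect p A f"
  by (simp add: rsub_expect_def sum_distrib_left mult_ac)

lemma rsub_expect_sum: "rsub_expect p A (\<lambda>X. \<Sum>i\<in>I. f i X) = (\<Sum>i\<in>I. rsub_expect p A (f i))"
  unfolding rsub_expect_def sum_distrib_left by (rule sum.swap)

lemma rsub_expect_cong:
  "(\<And>X. X \<subseteq> A \<Longrightarrow> f X = g X) \<Longrightarrow> rsub_expect p A f = rsub_expect p A g"
  unfolding rsub_expect_def by (intro sum.cong) auto

lemma rsub_expect_const [simp]: "finite A \<Longrightarrow> rsub_expect p A (\<lambda>_. c) = c"
proof (induction A rule: finite_induct)
  case (insert a A)
  have "rsub_expect p ({a} \<union> A) (\<lambda>_. c) = c"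
    using insert by (subst rsub_expect_union) (auto simp: algebra_simps)
  then show ?case by simp
qed simp

lemma rsub_expect_mono:
  assumes "0 \<le> p" "p \<le> 1" "\<And>X. X \<subseteq> A \<Longrightarrow> f X \<le> g X"
  shows "rsub_expect p A f \<le> rsub_expect p A g"
  unfolding rsub_expect_def using assms
  by (intro sum_mono mult_left_mono prod_nonneg) auto

lemma rsub_prob_empty:
  assumes "finite F"
  shows "rsub_expect p F (\<lambda>X. of_bool (X = {})) = (1 - p) ^ card F"
proof -
  have "rsub_expect p F (\<lambda>X. of_bool (X = {})) =
    (\<Sum>X\<in>{{}}. (\<Prod>a\<in>F. if a \<in> X then p else 1 - p) * of_bool (X = {}))"
    unfolding rsub_expect_def using assms by (intro sum.mono_neutral_right) auto
  then show ?thesis by simp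
qed

lemma rsub_prob_avoid:
  assumes "finite A" "F \<subseteq> A"
  shows "rsub_expect p A (\<lambda>X. of_bool (X \<inter> F = {})) = (1 - p) ^ card F"
proof -
  have fin: "finite F" using assms finite_subset by blast
  have "rsub_expect p (F \<union> (A - F)) (\<lambda>X. of_bool (X \<inter> F = {})) =
     rsub_expect p F (\<lambda>X. rsub_expect p (A - F) (\<lambda>Y. of_bool ((X \<union> Y) \<inter> F = {})))"
    using assms fin by (intro rsub_expect_union) auto
  also have "\<dots> = rsub_expect p F (\<lambda>X. rsub_expect p (A - F) (\<lambda>Y. of_bool (X = {})))"
    by (intro rsub_expect_cong arg_cong[where f = of_bool]) auto
  also have "\<dots> = (1 - p) ^ card F" using assms fin by (simp add: rsub_prob_empty)
  finally show ?thesis using assms by (simp add: Un_absorb1)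
qed

text \<open>Hitting disjoint sets are independent events. The induction splits off
  \<open>C m\<close> from the ground set, so \<open>A\<close> has to vary.\<close>

lemma rsub_prob_hits_all:
  fixes m :: nat
  assumes "finite A" "\<And>c. c < m \<Longrightarrow> C c \<subseteq> A" "disjoint_family_on C {..<m}"
  shows "rsub_expect p A (\<lambda>X. of_bool (\<forall>c<m. X \<inter> C c \<noteq> {})) = (\<Prod>c<m. 1 - (1 - p) ^ card (C c))"
  using assms
proof (induction m arbitrary: A)
  case (Suc m)
  have sub: "C m \<subseteq> A" using Suc.prems by auto
  have fin: "finite (C m)" using sub Suc.prems finite_subset by blast
  have dis: "C c \<inter> C m = {}" if "c < m" for c
    using Suc.prems(3) that by (auto simp: disjoint_family_on_def)
  have IH: "rsub_expect p (A - C m) (\<lambda>Y. of_bool (\<forall>c<m. Y \<inter> C c \<noteq> {})) = (\<Prod>c<m. 1 - (1 - p) ^ card (C c))"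
  proof (intro Suc.IH)
    show "C c \<subseteq> A - C m" if "c < m" for c
      using Suc.prems(2)[of c] dis[OF that] that by auto
    show "disjoint_family_on C {..<m}"
      using Suc.prems(3) by (rule disjoint_family_on_mono[rotated]) auto
  qed (use Suc.prems in simp)
  have "rsub_expect p (C m \<union> (A - C m)) (\<lambda>X. of_bool (\<forall>c<Suc m. X \<inter> C c \<noteq> {})) =
     rsub_expect p (C m) (\<lambda>X. rsub_expect p (A - C m) (\<lambda>Y. of_bool (\<forall>c<Suc m. (X \<union> Y) \<inter> C c \<noteq> {})))"
    using Suc.prems fin by (intro rsub_expect_union) auto
  also have "\<dots> = rsub_expect p (C m) (\<lambda>X. rsub_expect p (A - C m)
      (\<lambda>Y. (1 - of_bool (X = {})) * of_bool (\<forall>c<m. Y \<inter> C c \<noteq> {})))"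
  proof (intro rsub_expect_cong)
    fix X Y assume "X \<subseteq> C m" "Y \<subseteq> A - C m"
    then have "(X \<union> Y) \<inter> C m = X" "\<And>c. c < m \<Longrightarrow> (X \<union> Y) \<inter> C c = Y \<inter> C c"
      using dis by blast+
    then show "of_bool (\<forall>c<Suc m. (X \<union> Y) \<inter> C c \<noteq> {}) =
        (1 - of_bool (X = {})) * (of_bool (\<forall>c<m. Y \<inter> C c \<noteq> {}) :: real)"
      by (auto simp: less_Suc_eq)
  qed
  also have "\<dots> = (1 - (1 - p) ^ card (C m)) * (\<Prod>c<m. 1 - (1 - p) ^ card (C c))"
    using fin by (simp add: rsub_expect_cmult IH rsub_expect_diff rsub_prob_empty mult.commute[of _ "prod _ _"])
  finally show ?case using sub by (simp add: Un_absorb1)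
qed simp

section \<open>Colouring the random graph vertex by vertex\<close>

definition colorable :: "nat \<Rightarrow> nat \<Rightarrow> nat set set \<Rightarrow> bool" where
  "colorable n m E \<longleftrightarrow> (\<exists>f. (\<forall>v<n. f v < m) \<and> (\<forall>i j. {i, j} \<in> E \<longrightarrow> f i \<noteq> f j))"

lemma all_pairs_Suc: "all_pairs (Suc n) = all_pairs n \<union> (\<lambda>a. {a, n}) ` {..<n}"
proof (intro Set.set_eqI iffI)
  fix e assume "e \<in> all_pairs (Suc n)"
  then obtain i j where "i < Suc n" "j < Suc n" "i \<noteq> j" "e = {i, j}"
    by (auto simp: all_pairs_def)
  then show "e \<in> all_pairs n \<union> (\<lambda>a. {a, n}) ` {..<n}"
    by (cases "i = n"; cases "j = n") (auto simp: all_pairs_def less_Suc_eq)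
next
  fix e assume "e \<in> all_pairs n \<union> (\<lambda>a. {a, n}) ` {..<n}"
  then show "e \<in> all_pairs (Suc n)"
  proof
    assume "e \<in> all_pairs n"
    then show ?thesis unfolding all_pairs_def using less_SucI by blast
  next
    assume "e \<in> (\<lambda>a. {a, n}) ` {..<n}"
    then obtain a where "a < n" "e = {a, n}" by auto
    then show ?thesis unfolding all_pairs_def
      by (intro CollectI exI[of _ a] exI[of _ n]) auto
  qed
qed

text \<open>Convexity of q^t in t: each term lies above the tangent at t = n / m, and the linear
  corrections add up to something nonnegative because \<open>ln q \<le> 0\<close> and the exponents
  sum to at most \<open>n\<close>.\<close>

lemma sum_power_ge:
  fixes a :: "nat \<Rightarrow> nat"
  assumes "0 < q" "q \<le> 1" "m > 0" "(\<Sum>c<m. a c) \<le> n"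
  shows "real m * exp (ln q * (n / m)) \<le> (\<Sum>c<m. q ^ a c)"
proof -
  let ?e = "exp (ln q * (n / m))"
  have tangent: "?e * (1 + ln q * (real (a c) - n / m)) \<le> q ^ a c" for c
  proof -
    have "?e * (1 + ln q * (real (a c) - n / m)) \<le> ?e * exp (ln q * (real (a c) - n / m))"
      by (intro mult_left_mono exp_ge_add_one_self) simp
    also have "\<dots> = exp (ln q * real (a c))" by (simp add: exp_add[symmetric] algebra_simps)
    also have "\<dots> = q ^ a c" using assms by (simp add: mult.commute[of "ln q"] exp_of_nat_mult)
    finally show ?thesis .
  qed
  have "0 \<le> ln q * ((\<Sum>c<m. real (a c)) - n)"
    using assms by (intro mult_nonpos_nonpos) (auto simp flip: of_nat_sum)
  then have "real m * ?e \<le> ?e * (m + ln q * ((\<Sum>c<m. real (a c)) - n))"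
    by (simp add: distrib_left mult.commute)
  also have "\<dots> = (\<Sum>c<m. ?e * (1 + ln q * (real (a c) - n / m)))"
    using assms by (simp add: sum_distrib_left[symmetric] sum.distrib sum_subtractf)
  also have "\<dots> \<le> (\<Sum>c<m. q ^ a c)" by (intro sum_mono tangent)
  finally show ?thesis .
qed

text \<open>The edges from \<open>n\<close> into different colour classes are independent, and 1 - t
  \<le> exp (-t) turns the product over colours into the sum bounded by convexity. Using
  \<open>N\<close> in place of \<open>n\<close> gives the same bound at every stage of the
  colouring.\<close>

lemma prob_no_extension:
  fixes f :: "nat \<Rightarrow> nat"
  assumes p: "0 \<le> p" "p < 1" and "m > 0" and "n \<le> (N::nat)"
  shows "rsub_expect p ((\<lambda>a. {a, n}) ` {..<n})
      (\<lambda>Y. of_bool (\<forall>c<m. Y \<inter> (\<lambda>a. {a, n}) ` {a. a < n \<and> f a = c} \<noteq> {}))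
    \<le> exp (- (real m * exp (ln (1 - p) * (N / m))))"
proof -
  have inj: "inj_on (\<lambda>a. {a, n}) {..<n}" by (auto simp: inj_on_def doubleton_eq_iff)
  let ?C = "\<lambda>c. (\<lambda>a. {a, n}) ` {a. a < n \<and> f a = c}"
  have card: "card (?C c) = card {a. a < n \<and> f a = c}" for c
    by (intro card_image inj_on_subset[OF inj]) auto
  have "(\<Sum>c<m. card (?C c)) = card (\<Union>c<m. {a. a < n \<and> f a = c})"
    unfolding card by (subst card_UN_disjoint) auto
  also have "\<dots> \<le> card {..<n}" by (intro card_mono) auto
  finally have sum: "(\<Sum>c<m. card (?C c)) \<le> N" using assms(4) by simp
  have "rsub_expect p ((\<lambda>a. {a, n}) ` {..<n}) (\<lambda>Y. of_bool (\<forall>c<m. Y \<inter> ?C c \<noteq> {}))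
      = (\<Prod>c<m. 1 - (1 - p) ^ card (?C c))"
    by (intro rsub_prob_hits_all) (auto simp: disjoint_family_on_def doubleton_eq_iff)
  also have "\<dots> \<le> (\<Prod>c<m. exp (- ((1 - p) ^ card (?C c))))"
  proof (intro prod_mono conjI)
    fix c
    show "0 \<le> 1 - (1 - p) ^ card (?C c)" using p by (simp add: power_le_one)
    show "1 - (1 - p) ^ card (?C c) \<le> exp (- ((1 - p) ^ card (?C c)))"
      using exp_ge_add_one_self[of "- ((1 - p) ^ card (?C c))"] by simp
  qed
  also have "\<dots> = exp (- (\<Sum>c<m. (1 - p) ^ card (?C c)))"
    by (simp add: exp_sum[symmetric] sum_negf)
  also have "\<dots> \<le> exp (- (real m * exp (ln (1 - p) * (N / m))))"
    using sum_power_ge[OF _ _ \<open>m > 0\<close> sum, of "1 - p"] p by simp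
  finally show ?thesis .
qed

text \<open>The star at the new vertex is independent of the graph on the earlier ones, so each new
  vertex adds at most \<open>?eps\<close> to the failure probability.\<close>

lemma prob_not_colorable:
  assumes p: "0 \<le> p" "p < 1" and "m > 0" and "n \<le> (N::nat)"
  shows "gnp_prob n p (\<lambda>E. \<not> colorable n m E) \<le> n * exp (- (real m * exp (ln (1 - p) * (N / m))))"
  using assms(4)
proof (induction n)
  case 0
  have "colorable 0 m {}" by (simp add: colorable_def)
  moreover have "all_pairs 0 = {}" by (simp add: all_pairs_def)
  ultimately show ?case by (simp add: gnp_prob_eq_expect)
next
  case (Suc n)
  let ?eps = "exp (- (real m * exp (ln (1 - p) * (N / m))))"
  let ?st = "(\<lambda>a. {a, n}) ` {..<n}"
  have dis: "all_pairs n \<inter> ?st = {}"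
    using doubleton_in_all_pairs by blast
  \<comment> \<open>Here \<open>X\<close> is the graph on the first \<open>n\<close> vertices,
    already revealed. If it is not colourable the trivial bound 1 suffices; otherwise one fixed
    colouring of it is to be extended.\<close>
  have step: "rsub_expect p ?st (\<lambda>Y. of_bool (\<not> colorable (Suc n) m (X \<union> Y)))
      \<le> of_bool (\<not> colorable n m X) + ?eps" if X: "X \<subseteq> all_pairs n" for X
  proof (cases "colorable n m X")
    case False
    have "rsub_expect p ?st (\<lambda>Y. of_bool (\<not> colorable (Suc n) m (X \<union> Y))) \<le> rsub_expect p ?st (\<lambda>_. 1)"
      using p by (intro rsub_expect_mono) auto
    then show ?thesis using False by (simp add: add_increasing2)
  next
    case True
    then obtain f where f: "\<And>v. v < n \<Longrightarrow> f v < m" "\<And>i j. {i, j} \<in> X \<Longrightarrow> f i \<noteq> f j"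
      by (auto simp: colorable_def)
    have ext: "colorable (Suc n) m (X \<union> Y)"
      if Y: "Y \<subseteq> ?st" "c < m" "Y \<inter> (\<lambda>a. {a, n}) ` {a. a < n \<and> f a = c} = {}" for Y c
    proof -
      have "(f(n := c)) i \<noteq> (f(n := c)) j" if "{i, j} \<in> X \<union> Y" for i j
      proof (cases "{i, j} \<in> X")
        case True
        then have "i \<noteq> n" "j \<noteq> n" using X doubleton_in_all_pairs by (metis less_irrefl subsetD)+
        then show ?thesis using f True by simp
      next
        case False
        then obtain a where a: "a < n" "{i, j} = {a, n}" "{a, n} \<in> Y"
        proof -
          have "{i, j} \<in> Y" using \<open>{i, j} \<in> X \<union> Y\<close> False by blast
          with Y(1) have "{i, j} \<in> ?st" by blast
          then obtain a where "a < n" "{i, j} = {a, n}" by auto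
          then show thesis using \<open>{i, j} \<in> Y\<close> by (intro that[of a]) simp_all
        qed
        have "f a \<noteq> c"
        proof
          assume "f a = c"
          then have "{a, n} \<in> Y \<inter> (\<lambda>a. {a, n}) ` {a. a < n \<and> f a = c}" using a by simp
          then show False using Y by simp
        qed
        moreover have "i = a \<and> j = n \<or> i = n \<and> j = a"
          using a(2) by (simp add: doubleton_eq_iff)
        ultimately show ?thesis using a(1) by auto
      qed
      moreover have "\<forall>v<Suc n. (f(n := c)) v < m" using f Y by (auto simp: less_Suc_eq)
      ultimately show ?thesis unfolding colorable_def by blast
    qed
    have "rsub_expect p ?st (\<lambda>Y. of_bool (\<not> colorable (Suc n) m (X \<union> Y)))
      \<le> rsub_expect p ?st (\<lambda>Y. of_bool (\<forall>c<m. Y \<inter> (\<lambda>a. {a, n}) ` {a. a < n \<and> f a = c} \<noteq> {}))"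
    proof (intro rsub_expect_mono)
      fix Y assume "Y \<subseteq> ?st"
      then show "of_bool (\<not> colorable (Suc n) m (X \<union> Y)) \<le>
        (of_bool (\<forall>c<m. Y \<inter> (\<lambda>a. {a, n}) ` {a. a < n \<and> f a = c} \<noteq> {}) :: real)"
        using ext[of Y] by (cases "colorable (Suc n) m (X \<union> Y)") auto
    qed (use p in auto)
    also have "\<dots> \<le> ?eps" using p assms(3) Suc.prems by (intro prob_no_extension) auto
    finally show ?thesis using True by simp
  qed
  have "gnp_prob (Suc n) p (\<lambda>E. \<not> colorable (Suc n) m E) =
     rsub_expect p (all_pairs n) (\<lambda>X. rsub_expect p ?st (\<lambda>Y. of_bool (\<not> colorable (Suc n) m (X \<union> Y))))"
    unfolding gnp_prob_eq_expect all_pairs_Suc using dis by (intro rsub_expect_union) auto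
  also have "\<dots> \<le> rsub_expect p (all_pairs n) (\<lambda>X. of_bool (\<not> colorable n m X) + ?eps)"
    using p step by (intro rsub_expect_mono) auto
  also have "\<dots> = gnp_prob n p (\<lambda>E. \<not> colorable n m E) + ?eps"
    by (simp add: rsub_expect_add gnp_prob_eq_expect)
  also have "\<dots> \<le> Suc n * ?eps" using Suc by (simp add: algebra_simps)
  finally show ?case .
qed

text \<open>Colour c is placed at the c-th standard basis vector divided by \<open>sqrt 2\<close>;
  any two of these points are at distance 1.\<close>

lemma colorable_imp_unit_distance_graph:
  assumes "colorable n m E" "E \<subseteq> all_pairs n"
  shows "unit_distance_graph m E"
proof -
  obtain f where f: "\<And>v. v < n \<Longrightarrow> f v < m" "\<And>i j. {i, j} \<in> E \<Longrightarrow> f i \<noteq> f j"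
    using assms by (auto simp: colorable_def)
  define u :: "nat \<Rightarrow> nat \<Rightarrow> real" where "u i k = of_bool (k = f i) / sqrt 2" for i k
  have "(\<Sum>k<m. (u i k - u j k)\<^sup>2) = 1" if "{i, j} \<in> E" for i j
  proof -
    have ij: "f i < m" "f j < m" "f i \<noteq> f j"
      using that assms(2) f doubleton_in_all_pairs by blast+
    have "(\<Sum>k<m. (u i k - u j k)\<^sup>2) = (\<Sum>k\<in>{f i, f j}. (u i k - u j k)\<^sup>2)"
      using ij by (intro sum.mono_neutral_right) (auto simp: u_def)
    then show ?thesis using ij by (simp add: u_def power_divide)
  qed
  then show ?thesis unfolding unit_distance_graph_def by (intro exI[of _ u]) auto
qed

lemma colorable_num_vertices: "E \<subseteq> all_pairs n \<Longrightarrow> colorable n n E"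
  unfolding colorable_def by (intro exI[of _ id]) (use doubleton_in_all_pairs in auto)

text \<open>The identity colouring supplies a dimension that works, so the \<open>LEAST\<close> is
  attained.\<close>

lemma unit_distance_graph_min_ud_dim:
  assumes "E \<subseteq> all_pairs n"
  shows "unit_distance_graph (min_ud_dim E) E"
  unfolding min_ud_dim_def
  using colorable_imp_unit_distance_graph[OF colorable_num_vertices[OF assms] assms] by (rule LeastI)

section \<open>Rank and sparse row bases\<close>

text \<open>Gaussian elimination: if equation \<open>b\<close> involves the unknown
  \<open>a0\<close>, then \<open>c'\<close> is the system with \<open>a0\<close> eliminated, and
  \<open>- s\<close> is the value of \<open>a0\<close> that solves equation
  \<open>b\<close>.\<close>

lemma homogeneous_system_nontrivial:
  fixes c :: "'a \<Rightarrow> 'b \<Rightarrow> real"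
  assumes "finite B" "finite J" "card B < card J"
  shows "\<exists>x. (\<exists>a\<in>J. x a \<noteq> 0) \<and> (\<forall>b\<in>B. (\<Sum>a\<in>J. x a * c a b) = 0)"
  using assms
proof (induction B arbitrary: J c rule: finite_induct)
  case empty
  then have "J \<noteq> {}" by auto
  then show ?case by (intro exI[of _ "\<lambda>_. 1"]) auto
next
  case (insert b B)
  show ?case
  proof (cases "\<forall>a\<in>J. c a b = 0")
    case True
    moreover obtain x where "\<exists>a\<in>J. x a \<noteq> 0" "\<forall>b\<in>B. (\<Sum>a\<in>J. x a * c a b) = 0"
      using insert.IH[of J c] insert.prems insert.hyps by auto
    ultimately show ?thesis by (intro exI[of _ x]) auto
  next
    case False
    then obtain a0 where a0: "a0 \<in> J" "c a0 b \<noteq> 0" by auto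
    define c' where "c' a b' = c a b' - c a b / c a0 b * c a0 b'" for a b'
    have "card B < card (J - {a0})" using insert a0 by simp
    then obtain x where x: "\<exists>a\<in>J - {a0}. x a \<noteq> 0" "\<forall>b\<in>B. (\<Sum>a\<in>J - {a0}. x a * c' a b) = 0"
      using insert.IH[of "J - {a0}" c'] insert.prems by auto
    define s where "s = (\<Sum>a\<in>J - {a0}. x a * c a b) / c a0 b"
    define y where "y = x(a0 := - s)"
    have split: "(\<Sum>a\<in>J. y a * c a b') = (\<Sum>a\<in>J - {a0}. x a * c a b') - s * c a0 b'" for b'
    proof -
      have "(\<Sum>a\<in>J. y a * c a b') = y a0 * c a0 b' + (\<Sum>a\<in>J - {a0}. y a * c a b')"
        using a0 insert.prems by (intro sum.remove) auto
      moreover have "(\<Sum>a\<in>J - {a0}. y a * c a b') = (\<Sum>a\<in>J - {a0}. x a * c a b')"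
        by (intro sum.cong) (auto simp: y_def)
      ultimately show ?thesis by (simp add: y_def)
    qed
    have "(\<Sum>a\<in>J. y a * c a b') = 0" if b': "b' \<in> B" for b'
    proof -
      have "0 = (\<Sum>a\<in>J - {a0}. x a * c' a b')" using x b' by simp
      also have "\<dots> = (\<Sum>a\<in>J - {a0}. x a * c a b') - s * c a0 b'"
        by (simp add: c'_def s_def right_diff_distrib sum_subtractf sum_divide_distrib sum_distrib_left mult_ac)
      finally show ?thesis using split by simp
    qed
    moreover have "(\<Sum>a\<in>J. y a * c a b) = 0" using a0 by (simp add: split s_def)
    moreover have "\<exists>a\<in>J. y a \<noteq> 0" using x(1) by (auto simp: y_def)
    ultimately show ?thesis by (intro exI[of _ y]) auto
  qed
qed

text \<open>Rows are restricted to the columns in \<open>S\<close>, so that passing to a submatrix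
  only changes the index sets and never \<open>M\<close>.\<close>

definition rows_indep :: "('a \<Rightarrow> 'b \<Rightarrow> real) \<Rightarrow> 'b set \<Rightarrow> 'a set \<Rightarrow> bool" where
  "rows_indep M S J \<longleftrightarrow> (\<forall>x. (\<forall>j\<in>S. (\<Sum>a\<in>J. x a * M a j) = 0) \<longrightarrow> (\<forall>a\<in>J. x a = 0))"

definition row_in_span :: "('a \<Rightarrow> 'b \<Rightarrow> real) \<Rightarrow> 'b set \<Rightarrow> 'a set \<Rightarrow> 'a \<Rightarrow> bool" where
  "row_in_span M S B i \<longleftrightarrow> (\<exists>c. \<forall>j\<in>S. M i j = (\<Sum>b\<in>B. c b * M b j))"

text \<open>With more rows than vectors \<open>v b\<close>, the coefficient rows \<open>c i\<close>
  satisfy a nontrivial relation, which the rows of \<open>M\<close> inherit. The \<open>v b\<close>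
  may be any vectors, so a factorization of \<open>M\<close> bounds its rank.\<close>

lemma rows_indep_card_le:
  assumes "finite B" "finite J" "rows_indep M S J"
    and eq: "\<And>i j. i \<in> J \<Longrightarrow> j \<in> S \<Longrightarrow> M i j = (\<Sum>b\<in>B. c i b * v b j)"
  shows "card J \<le> card B"
proof (rule ccontr)
  assume "\<not> card J \<le> card B"
  then obtain x where x: "\<exists>a\<in>J. x a \<noteq> 0" "\<And>b. b \<in> B \<Longrightarrow> (\<Sum>a\<in>J. x a * c a b) = 0"
    using homogeneous_system_nontrivial[of B J c] assms by auto
  have "(\<Sum>a\<in>J. x a * M a j) = 0" if "j \<in> S" for j
  proof -
    have "(\<Sum>a\<in>J. x a * M a j) = (\<Sum>a\<in>J. \<Sum>b\<in>B. x a * c a b * v b j)"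
      using eq that by (simp add: sum_distrib_left mult.assoc)
    also have "\<dots> = (\<Sum>b\<in>B. (\<Sum>a\<in>J. x a * c a b) * v b j)"
      by (subst sum.swap) (simp add: sum_distrib_right)
    finally show ?thesis using x(2) by simp
  qed
  with assms(3) x(1) show False unfolding rows_indep_def by blast
qed

lemma rows_indep_card_le_span:
  assumes "finite B" "finite J" "rows_indep M S J" "\<And>i. i \<in> J \<Longrightarrow> row_in_span M S B i"
  shows "card J \<le> card B"
proof -
  obtain c where "\<And>i j. i \<in> J \<Longrightarrow> j \<in> S \<Longrightarrow> M i j = (\<Sum>b\<in>B. c i b * M b j)"
    using assms(4) unfolding row_in_span_def by metis
  then show ?thesis using rows_indep_card_le[OF assms(1-3), of c M] by blast
qed

lemma row_in_span_mem:
  assumes "finite B" "i \<in> B"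
  shows "row_in_span M S B i"
proof -
  have "(\<Sum>b\<in>B. (if b = i then 1 else 0) * M b j) = (\<Sum>b\<in>B. if b = i then M b j else 0)" for j
    by (intro sum.cong) auto
  then have "\<forall>j\<in>S. M i j = (\<Sum>b\<in>B. (if b = i then 1 else 0) * M b j)" using assms by simp
  then show ?thesis unfolding row_in_span_def
    by (intro exI[of _ "\<lambda>b. if b = i then 1 else 0"])
qed

lemma row_in_span_superset:
  assumes "row_in_span M S A i" "A \<subseteq> B" "finite B"
  shows "row_in_span M S B i"
proof -
  obtain c where c: "\<And>j. j \<in> S \<Longrightarrow> M i j = (\<Sum>b\<in>A. c b * M b j)"
    using assms(1) unfolding row_in_span_def by blast
  have "(\<Sum>b\<in>A. c b * M b j) = (\<Sum>b\<in>B. (if b \<in> A then c b else 0) * M b j)" for j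
    using assms(2,3) by (intro sum.mono_neutral_cong_left) auto
  then have "\<forall>j\<in>S. M i j = (\<Sum>b\<in>B. (if b \<in> A then c b else 0) * M b j)" using c by simp
  then show ?thesis unfolding row_in_span_def
    by (intro exI[of _ "\<lambda>b. if b \<in> A then c b else 0"])
qed

lemma rows_indep_insert:
  assumes "rows_indep M S J" "finite J" "\<not> row_in_span M S J i"
  shows "rows_indep M S (insert i J)"
  unfolding rows_indep_def
proof (intro allI impI)
  fix x assume x: "\<forall>j\<in>S. (\<Sum>a\<in>insert i J. x a * M a j) = 0"
  have i: "i \<notin> J" using assms(3) row_in_span_mem[OF assms(2), of i M S] by auto
  have eq: "x i * M i j = - (\<Sum>a\<in>J. x a * M a j)" if "j \<in> S" for j
  proof -
    have "x i * M i j + (\<Sum>a\<in>J. x a * M a j) = 0" using x that i assms(2) by auto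
    then show ?thesis by linarith
  qed
  have "x i = 0"
  proof (rule ccontr)
    assume "x i \<noteq> 0"
    then have "M i j = (\<Sum>a\<in>J. (- x a / x i) * M a j)" if "j \<in> S" for j
    proof -
      have "M i j = x i * M i j / x i" using \<open>x i \<noteq> 0\<close> by simp
      also have "\<dots> = - (\<Sum>a\<in>J. x a * M a j) / x i" using eq[OF that] by simp
      also have "\<dots> = (\<Sum>a\<in>J. (- x a / x i) * M a j)"
        by (simp add: sum_negf sum_divide_distrib)
      finally show ?thesis .
    qed
    then have "row_in_span M S J i"
      unfolding row_in_span_def by (intro exI[of _ "\<lambda>a. - x a / x i"] ballI)
    then show False using assms(3) by blast
  qed
  then have "\<forall>j\<in>S. (\<Sum>a\<in>J. x a * M a j) = 0" using eq by (metis mult_zero_left neg_equal_0_iff_equal)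
  then have "\<forall>a\<in>J. x a = 0" using assms(1) unfolding rows_indep_def by blast
  then show "\<forall>a\<in>insert i J. x a = 0" using \<open>x i = 0\<close> by blast
qed

lemma rows_indep_not_in_span:
  assumes "rows_indep M S B" "finite B" "b \<in> B"
  shows "\<not> row_in_span M S (B - {b}) b"
proof
  assume "row_in_span M S (B - {b}) b"
  then obtain c where c: "\<And>j. j \<in> S \<Longrightarrow> M b j = (\<Sum>a\<in>B - {b}. c a * M a j)"
    unfolding row_in_span_def by blast
  define x where "x = c(b := -1)"
  have "(\<Sum>a\<in>B. x a * M a j) = 0" if "j \<in> S" for j
  proof -
    have "(\<Sum>a\<in>B. x a * M a j) = x b * M b j + (\<Sum>a\<in>B - {b}. x a * M a j)"
      using assms by (intro sum.remove) auto
    also have "(\<Sum>a\<in>B - {b}. x a * M a j) = (\<Sum>a\<in>B - {b}. c a * M a j)"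
      by (intro sum.cong) (auto simp: x_def)
    finally show ?thesis using c[OF that] by (simp add: x_def)
  qed
  then have "x b = 0" using assms unfolding rows_indep_def by blast
  then show False by (simp add: x_def)
qed

text \<open>An inclusion-maximal independent set between \<open>J\<close> and \<open>T\<close> spans
  all rows in \<open>T\<close>.\<close>

lemma rows_indep_extend_basis:
  assumes "finite T" "J \<subseteq> T" "rows_indep M S J"
  obtains B where "J \<subseteq> B" "B \<subseteq> T" "rows_indep M S B" "\<And>i. i \<in> T \<Longrightarrow> row_in_span M S B i"
proof -
  let ?F = "{B. B \<subseteq> T \<and> rows_indep M S B}"
  have "finite ?F" using assms by simp
  moreover have "J \<in> ?F" using assms by simp
  ultimately obtain B where B: "B \<in> ?F" "J \<subseteq> B" "\<And>B'. B' \<in> ?F \<Longrightarrow> B \<subseteq> B' \<Longrightarrow> B = B'"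
    using finite_has_maximal2[of ?F J] by auto
  have fin: "finite B" using B assms finite_subset by blast
  have "row_in_span M S B i" if "i \<in> T" for i
  proof (rule ccontr)
    assume "\<not> row_in_span M S B i"
    then have "insert i B \<in> ?F" "i \<notin> B"
      using rows_indep_insert[of M S B i] row_in_span_mem[of B i M S] B(1) that fin by auto
    then show False using B(3)[of "insert i B"] by blast
  qed
  then show thesis using B that by blast
qed

lemma rows_indep_mono_cols: "rows_indep M T J \<Longrightarrow> T \<subseteq> S \<Longrightarrow> rows_indep M S J"
  unfolding rows_indep_def by blast

section \<open>Balanced principal submatrices and their sparse bases\<close>

definition principal_rank :: "('a \<Rightarrow> 'a \<Rightarrow> real) \<Rightarrow> 'a set \<Rightarrow> nat" where
  "principal_rank M S = Max (card ` {J. J \<subseteq> S \<and> rows_indep M S J})"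

lemma principal_rank_ge:
  assumes "finite S" "J \<subseteq> S" "rows_indep M S J"
  shows "card J \<le> principal_rank M S"
  unfolding principal_rank_def using assms by (intro Max_ge) auto

lemma principal_rank_attained:
  assumes "finite S"
  obtains J where "J \<subseteq> S" "rows_indep M S J" "card J = principal_rank M S"
proof -
  have "rows_indep M S {}" by (simp add: rows_indep_def)
  then have "principal_rank M S \<in> card ` {J. J \<subseteq> S \<and> rows_indep M S J}"
    unfolding principal_rank_def using assms by (intro Max_in) auto
  then show thesis using that by force
qed

lemma principal_rank_eq_card_basis:
  assumes "finite S" "B \<subseteq> S" "rows_indep M S B" "\<And>i. i \<in> S \<Longrightarrow> row_in_span M S B i"
  shows "principal_rank M S = card B"
proof (rule antisym)
  obtain J where "J \<subseteq> S" "rows_indep M S J" "card J = principal_rank M S"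
    using principal_rank_attained[OF assms(1)] .
  then show "principal_rank M S \<le> card B"
    using rows_indep_card_le_span[of B J M S] assms(4)
      finite_subset[OF _ assms(1)] assms(2) by (metis subsetD)
qed (use principal_rank_ge assms in blast)

text \<open>No principal submatrix inside \<open>S\<close> has a smaller ratio of rank to size; the
  inequality is cross-multiplied to stay in the natural numbers.\<close>

definition rank_balanced :: "('a \<Rightarrow> 'a \<Rightarrow> real) \<Rightarrow> 'a set \<Rightarrow> bool" where
  "rank_balanced M S \<longleftrightarrow> (\<forall>T\<subseteq>S. principal_rank M S * card T \<le> principal_rank M T * card S)"

text \<open>A nonempty subset of \<open>V\<close> minimizing the ratio of rank to size is balanced;
  comparing it with \<open>V\<close> itself gives the last inequality.\<close>

lemma exists_rank_balanced:
  assumes "finite V" "V \<noteq> {}"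
  obtains S where "S \<subseteq> V" "S \<noteq> {}" "rank_balanced M S"
    "principal_rank M S * card V \<le> principal_rank M V * card S"
proof -
  let ?F = "Pow V - {{}}" and ?r = "\<lambda>S. real (principal_rank M S) / card S"
  have "finite ?F" "?F \<noteq> {}" using assms by auto
  then obtain S where "is_arg_min ?r (\<lambda>S. S \<in> ?F) S" using ex_is_arg_min_if_finite by blast
  then have S: "S \<in> ?F" "\<And>T. T \<in> ?F \<Longrightarrow> ?r S \<le> ?r T" by (auto simp: is_arg_min_linorder)
  have min: "principal_rank M S * card T \<le> principal_rank M T * card S" if "T \<subseteq> V" for T
  proof (cases "T = {}")
    case False
    have "card S > 0" "card T > 0" using S(1) False that assms finite_subset by (auto simp: card_gt_0_iff)
    moreover have "?r S \<le> ?r T" using S False that by auto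
    ultimately have "real (principal_rank M S) * card T \<le> principal_rank M T * card S"
      by (simp add: field_simps)
    then show ?thesis by (simp flip: of_nat_mult)
  qed simp
  show thesis using S(1) min by (intro that[of S]) (auto simp: rank_balanced_def)
qed

text \<open>Deleting the support of row i from a balanced set lowers the rank by at least one.\<close>

lemma rank_balanced_row_support:
  assumes "finite S" "rank_balanced M S" "i \<in> S" "M i i \<noteq> 0"
  shows "card S \<le> principal_rank M S * card {j\<in>S. M i j \<noteq> 0}"
proof -
  let ?N = "{j\<in>S. M i j \<noteq> 0}" and ?T = "{j\<in>S. M i j = 0}"
  obtain J where J: "J \<subseteq> ?T" "rows_indep M ?T J" "card J = principal_rank M ?T"
    using principal_rank_attained[of ?T M] assms by auto
  have iJ: "i \<notin> J" using J(1) assms(4) by auto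
  have fin: "finite J" using J(1) assms(1) by (auto intro: finite_subset[of J ?T])
  have "rows_indep M S (insert i J)"
    unfolding rows_indep_def
  proof (intro allI impI)
    fix x assume x: "\<forall>j\<in>S. (\<Sum>a\<in>insert i J. x a * M a j) = 0"
    \<comment> \<open>Row \<open>i\<close> vanishes on \<open>?T\<close>, so the columns in
      \<open>?T\<close> already kill the coefficients on \<open>J\<close>; column \<open>i\<close>
      with its nonzero diagonal entry then kills \<open>x i\<close>.\<close>
    have "\<forall>j\<in>?T. (\<Sum>a\<in>J. x a * M a j) = 0" using x iJ fin by auto
    then have "\<forall>a\<in>J. x a = 0" using J(2) unfolding rows_indep_def by blast
    moreover have "x i * M i i + (\<Sum>a\<in>J. x a * M a i) = 0" using x assms(3) iJ fin by auto
    ultimately show "\<forall>a\<in>insert i J. x a = 0" using assms(4) by simp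
  qed
  then have "Suc (principal_rank M ?T) \<le> principal_rank M S"
    using principal_rank_ge[of S "insert i J" M] J iJ fin assms by auto
  \<comment> \<open>With r and t the ranks on \<open>S\<close> and \<open>?T\<close>: (t + 1) |S|
    \<le> r |S| = r |?N| + r |?T| \<le> r |?N| + t |S|, where the last inequality is
    balance.\<close>
  then have "Suc (principal_rank M ?T) * card S \<le> principal_rank M S * card S" by (rule mult_le_mono1)
  moreover have "principal_rank M S * card ?T \<le> principal_rank M ?T * card S"
    using assms(2) unfolding rank_balanced_def by auto
  moreover have "card S = card ?N + card ?T"
    using assms(1) by (subst card_Un_disjoint[symmetric]) (auto intro: arg_cong[where f = card])
  ultimately show ?thesis by (simp add: distrib_left)
qed

text \<open>The greedy basis for the matroid of rows, taken in order of increasing weight s.\<close>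

lemma nested_basis:
  fixes s :: "'a \<Rightarrow> nat"
  assumes "finite S"
  shows "\<exists>B\<subseteq>{i\<in>S. s i < m}. rows_indep M S B \<and>
    (\<forall>t<m. \<forall>i\<in>S. s i \<le> t \<longrightarrow> row_in_span M S {b\<in>B. s b \<le> t} i)"
proof (induction m)
  case 0
  then show ?case by (intro exI[of _ "{}"]) (simp add: rows_indep_def)
next
  case (Suc m)
  then obtain B where B: "B \<subseteq> {i\<in>S. s i < m}" "rows_indep M S B"
    "\<And>t i. t < m \<Longrightarrow> i \<in> S \<Longrightarrow> s i \<le> t \<Longrightarrow> row_in_span M S {b\<in>B. s b \<le> t} i" by blast
  obtain B' where B': "B \<subseteq> B'" "B' \<subseteq> {i\<in>S. s i < Suc m}" "rows_indep M S B'"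
    "\<And>i. i \<in> {i\<in>S. s i < Suc m} \<Longrightarrow> row_in_span M S B' i"
  proof (rule rows_indep_extend_basis[of "{i\<in>S. s i < Suc m}" B M S])
    show "B \<subseteq> {i\<in>S. s i < Suc m}" using B(1) by auto
  qed (use assms B(2) in auto)
  have fin: "finite B'" using B' assms by (auto intro: finite_subset)
  \<comment> \<open>A row of weight below \<open>m\<close> is already spanned by \<open>B\<close>,
    so independence of \<open>B'\<close> allows only new rows of weight exactly \<open>m\<close>.
    Hence all levels below \<open>m\<close> stay unchanged.\<close>
  have new: "s b = m" if "b \<in> B'" "b \<notin> B" for b
  proof (rule ccontr)
    assume "s b \<noteq> m"
    then have "s b < m" "b \<in> S" using B'(2) that by auto
    then have "row_in_span M S {a\<in>B. s a \<le> s b} b" using B(3)[of "s b" b] by simp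
    then have "row_in_span M S (B' - {b}) b"
      by (rule row_in_span_superset) (use B'(1) that fin in auto)
    then show False using rows_indep_not_in_span[OF B'(3) fin that(1)] by simp
  qed
  have "row_in_span M S {b\<in>B'. s b \<le> t} i" if "t < Suc m" "i \<in> S" "s i \<le> t" for t i
  proof (cases "t = m")
    case True
    then have "{b\<in>B'. s b \<le> t} = B'" using B'(2) by auto
    then show ?thesis using B'(4)[of i] that by simp
  next
    case False
    then have "t < m" using that by simp
    then have "b \<in> B" if "b \<in> B'" "s b \<le> t" for b using new[of b] that by auto
    then have "{b\<in>B'. s b \<le> t} = {b\<in>B. s b \<le> t}" using B'(1) by blast
    then show ?thesis using B(3) that \<open>t < m\<close> by simp
  qed
  then show ?case using B'(2,3) by (intro exI[of _ B']) simp
qed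

text \<open>Layer-cake summation: \<open>s a\<close> is the number of t with t < \<open>s a\<close>,
  and the two sums are exchanged.\<close>

lemma sum_eq_sum_card_superlevel:
  fixes s :: "'a \<Rightarrow> nat"
  assumes "finite A" "\<And>a. a \<in> A \<Longrightarrow> s a \<le> m"
  shows "(\<Sum>a\<in>A. s a) = (\<Sum>t<m. card {a\<in>A. t < s a})"
proof -
  have "s a = (\<Sum>t<m. of_bool (t < s a))" if "a \<in> A" for a
  proof -
    have "{..<m} \<inter> {t. t < s a} = {..<s a}" using assms(2)[OF that] by auto
    then show ?thesis by simp
  qed
  then have "(\<Sum>a\<in>A. s a) = (\<Sum>a\<in>A. \<Sum>t<m. of_bool (t < s a))" by (rule sum.cong[OF refl])
  also have "\<dots> = (\<Sum>t<m. \<Sum>a\<in>A. of_bool (t < s a))" by (rule sum.swap)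
  finally show ?thesis using assms(1) by (simp add: Int_def)
qed

text \<open>For each threshold t, the greedy basis rows of weight at most t number at least the rank
  on the rows of weight at most t, which by balance is at least their proportional share. So heavy
  rows are not over-represented in the basis, and summing over t shows that its average weight is at
  most that of all rows.\<close>

lemma rank_balanced_sparse_basis:
  fixes s :: "'a \<Rightarrow> nat"
  assumes "finite S" "rank_balanced M S"
  obtains B where "B \<subseteq> S" "rows_indep M S B" "\<And>i. i \<in> S \<Longrightarrow> row_in_span M S B i"
    "card S * (\<Sum>b\<in>B. s b) \<le> principal_rank M S * (\<Sum>i\<in>S. s i)"
proof -
  obtain m where m: "\<And>i. i \<in> S \<Longrightarrow> s i < m"
    using finite_nat_set_iff_bounded[of "s ` S"] assms(1) by auto
  obtain B where B: "B \<subseteq> {i\<in>S. s i < Suc m}" "rows_indep M S B"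
    "\<And>t i. t < Suc m \<Longrightarrow> i \<in> S \<Longrightarrow> s i \<le> t \<Longrightarrow> row_in_span M S {b\<in>B. s b \<le> t} i"
    \<comment> \<open>Taking \<open>Suc m\<close> makes level \<open>t = m\<close>, above all
      weights, available; at that level the whole of \<open>B\<close> spans every row.\<close>
    using nested_basis[OF assms(1), of s "Suc m" M] by blast
  have BS: "B \<subseteq> S" and fin: "finite B" using B assms(1) by (auto intro: finite_subset)
  have span: "row_in_span M S B i" if "i \<in> S" for i
    using row_in_span_superset[OF B(3)[of m i], of B] m[OF that] that fin by auto
  have k: "principal_rank M S = card B"
    using assms(1) BS B(2) span by (rule principal_rank_eq_card_basis)
  have level: "card S * card {b\<in>B. t < s b} \<le> principal_rank M S * card {i\<in>S. t < s i}" if "t < m" for t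
  proof -
    let ?T = "{i\<in>S. s i \<le> t}"
    obtain J where J: "J \<subseteq> ?T" "rows_indep M ?T J" "card J = principal_rank M ?T"
      using principal_rank_attained[of ?T M] assms by auto
    have "card J \<le> card {b\<in>B. s b \<le> t}"
    proof (rule rows_indep_card_le_span)
      show "rows_indep M S J" using J(2) by (rule rows_indep_mono_cols) auto
      show "row_in_span M S {b\<in>B. s b \<le> t} i" if "i \<in> J" for i
        using B(3)[of t i] J that \<open>t < m\<close> by auto
      show "finite J" using J assms(1) by (auto intro: finite_subset)
    qed (use fin in simp)
    then have "principal_rank M ?T * card S \<le> card {b\<in>B. s b \<le> t} * card S" using J(3) by simp
    moreover have "principal_rank M S * card ?T \<le> principal_rank M ?T * card S"
      using assms(2) unfolding rank_balanced_def by auto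
    ultimately have "card B * card ?T \<le> card {b\<in>B. s b \<le> t} * card S" unfolding k by (rule order_trans[rotated])
    moreover have "card B = card {b\<in>B. s b \<le> t} + card {b\<in>B. t < s b}"
      using fin by (subst card_Un_disjoint[symmetric]) (auto intro: arg_cong[where f = card])
    then have "card B * card S = card {b\<in>B. s b \<le> t} * card S + card {b\<in>B. t < s b} * card S"
      by (metis distrib_right)
    moreover have "card S = card ?T + card {i\<in>S. t < s i}"
      using assms(1) by (subst card_Un_disjoint[symmetric]) (auto intro: arg_cong[where f = card])
    then have "card B * card S = card B * card ?T + card B * card {i\<in>S. t < s i}"
      by (metis distrib_left)
    ultimately show ?thesis using k by (simp add: mult.commute)
  qed
  have "card S * (\<Sum>b\<in>B. s b) = (\<Sum>t<m. card S * card {b\<in>B. t < s b})"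
    using m BS fin by (subst sum_eq_sum_card_superlevel[of B s m]) (auto simp: sum_distrib_left intro: less_imp_le)
  also have "\<dots> \<le> (\<Sum>t<m. principal_rank M S * card {i\<in>S. t < s i})"
    using level by (intro sum_mono) auto
  also have "\<dots> = principal_rank M S * (\<Sum>i\<in>S. s i)"
    using m assms(1) by (subst sum_eq_sum_card_superlevel[of S s m]) (auto simp: sum_distrib_left intro: less_imp_le)
  finally show thesis using that BS B(2) span by blast
qed

section \<open>Polynomial functions\<close>

text \<open>D bounds the degree in each single variable; this crude bound gives (D + 1) to the power card Z
  monomials, which is enough for the count of zero patterns.\<close>

definition poly_fun :: "'z set \<Rightarrow> nat \<Rightarrow> (('z \<Rightarrow> real) \<Rightarrow> real) \<Rightarrow> bool" where
  "poly_fun Z D f \<longleftrightarrow>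
    (\<exists>c. \<forall>x. f x = (\<Sum>\<alpha>\<in>Z \<rightarrow>\<^sub>E {..D}. c \<alpha> * (\<Prod>z\<in>Z. x z ^ \<alpha> z)))"

lemma poly_fun_monomial:
  assumes "finite Z" "\<And>z. z \<in> Z \<Longrightarrow> \<alpha> z \<le> D"
  shows "poly_fun Z D (\<lambda>x. \<Prod>z\<in>Z. x z ^ \<alpha> z)"
proof -
  \<comment> \<open>Exponent vectors in \<open>Z \<rightarrow>\<^sub>E {..D}\<close> are undefined
    outside \<open>Z\<close>, so \<open>\<alpha>\<close> has to be restricted before it can be one
    of them.\<close>
  let ?a = "restrict \<alpha> Z"
  have a: "?a \<in> Z \<rightarrow>\<^sub>E {..D}" using assms by auto
  have fin: "finite (Z \<rightarrow>\<^sub>E {..D})" using assms by (intro finite_PiE) auto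
  have "(\<Prod>z\<in>Z. x z ^ \<alpha> z) =
    (\<Sum>\<beta>\<in>Z \<rightarrow>\<^sub>E {..D}. (if \<beta> = ?a then 1 else 0) * (\<Prod>z\<in>Z. x z ^ \<beta> z))" for x :: "'a \<Rightarrow> real"
  proof -
    have "(\<Sum>\<beta>\<in>Z \<rightarrow>\<^sub>E {..D}. (if \<beta> = ?a then 1 else 0) * (\<Prod>z\<in>Z. x z ^ \<beta> z)) =
      (\<Sum>\<beta>\<in>Z \<rightarrow>\<^sub>E {..D}. if \<beta> = ?a then (\<Prod>z\<in>Z. x z ^ \<beta> z) else 0)"
      by (intro sum.cong) auto
    also have "\<dots> = (\<Prod>z\<in>Z. x z ^ ?a z)" using a fin by simp
    also have "\<dots> = (\<Prod>z\<in>Z. x z ^ \<alpha> z)" by (intro prod.cong) auto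
    finally show ?thesis by simp
  qed
  then show ?thesis unfolding poly_fun_def
    by (intro exI[of _ "\<lambda>\<beta>. if \<beta> = ?a then 1 else 0"] allI)
qed

lemma poly_fun_cmult:
  assumes "poly_fun Z D f"
  shows "poly_fun Z D (\<lambda>x. a * f x)"
proof -
  obtain c where "\<And>x. f x = (\<Sum>\<alpha>\<in>Z \<rightarrow>\<^sub>E {..D}. c \<alpha> * (\<Prod>z\<in>Z. x z ^ \<alpha> z))"
    using assms unfolding poly_fun_def by blast
  then show ?thesis unfolding poly_fun_def
    by (intro exI[of _ "\<lambda>\<alpha>. a * c \<alpha>"]) (simp add: sum_distrib_left mult.assoc)
qed

lemma poly_fun_add:
  assumes "poly_fun Z D f" "poly_fun Z D g"
  shows "poly_fun Z D (\<lambda>x. f x + g x)"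
proof -
  obtain c d where "\<And>x. f x = (\<Sum>\<alpha>\<in>Z \<rightarrow>\<^sub>E {..D}. c \<alpha> * (\<Prod>z\<in>Z. x z ^ \<alpha> z))"
    "\<And>x. g x = (\<Sum>\<alpha>\<in>Z \<rightarrow>\<^sub>E {..D}. d \<alpha> * (\<Prod>z\<in>Z. x z ^ \<alpha> z))"
    using assms unfolding poly_fun_def by blast
  then show ?thesis unfolding poly_fun_def
    by (intro exI[of _ "\<lambda>\<alpha>. c \<alpha> + d \<alpha>"]) (simp add: sum.distrib distrib_right)
qed

lemma poly_fun_zero: "poly_fun Z D (\<lambda>x. 0)"
  unfolding poly_fun_def by (intro exI[of _ "\<lambda>_. 0"]) simp

lemma poly_fun_sum:
  assumes "\<And>i. i \<in> I \<Longrightarrow> poly_fun Z D (f i)"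
  shows "poly_fun Z D (\<lambda>x. \<Sum>i\<in>I. f i x)"
proof (cases "finite I")
  case True
  then show ?thesis using assms
    by (induction I rule: finite_induct) (simp_all add: poly_fun_zero poly_fun_add)
qed (simp add: poly_fun_zero)

lemma poly_fun_const:
  assumes "finite Z"
  shows "poly_fun Z D (\<lambda>x. a)"
  using poly_fun_cmult[OF poly_fun_monomial[of Z "\<lambda>_. 0" D], of a] assms by simp

lemma poly_fun_var:
  assumes "finite Z" "z \<in> Z"
  shows "poly_fun Z 1 (\<lambda>x. x z)"
proof -
  have "(\<Prod>z'\<in>Z. x z' ^ (if z' = z then 1 else 0)) = x z" for x :: "'a \<Rightarrow> real"
  proof -
    have "(\<Prod>z'\<in>Z. x z' ^ (if z' = z then 1 else 0)) = (\<Prod>z'\<in>Z. if z' = z then x z' else 1)"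
      by (intro prod.cong) auto
    then show ?thesis using assms by simp
  qed
  then show ?thesis using poly_fun_monomial[of Z "\<lambda>z'. if z' = z then 1 else 0" 1] assms by simp
qed

lemma poly_fun_mult:
  assumes "finite Z" "poly_fun Z D f" "poly_fun Z E g"
  shows "poly_fun Z (D + E) (\<lambda>x. f x * g x)"
proof -
  obtain c d where cd: "\<And>x. f x = (\<Sum>\<alpha>\<in>Z \<rightarrow>\<^sub>E {..D}. c \<alpha> * (\<Prod>z\<in>Z. x z ^ \<alpha> z))"
    "\<And>x. g x = (\<Sum>\<alpha>\<in>Z \<rightarrow>\<^sub>E {..E}. d \<alpha> * (\<Prod>z\<in>Z. x z ^ \<alpha> z))"
    using assms unfolding poly_fun_def by blast
  have "f x * g x = (\<Sum>\<alpha>\<in>Z \<rightarrow>\<^sub>E {..D}. \<Sum>\<beta>\<in>Z \<rightarrow>\<^sub>E {..E}.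
      (c \<alpha> * d \<beta>) * (\<Prod>z\<in>Z. x z ^ (\<alpha> z + \<beta> z)))" for x
    unfolding cd sum_product by (intro sum.cong refl) (simp add: power_add prod.distrib mult_ac)
  then show ?thesis
  proof (simp only:, intro poly_fun_sum poly_fun_cmult poly_fun_monomial assms(1))
    fix \<alpha> \<beta> z assume "\<alpha> \<in> Z \<rightarrow>\<^sub>E {..D}" "\<beta> \<in> Z \<rightarrow>\<^sub>E {..E}" "z \<in> Z"
    then have "\<alpha> z \<in> {..D}" "\<beta> z \<in> {..E}" by (auto dest: PiE_mem)
    then show "\<alpha> z + \<beta> z \<le> D + E" by simp
  qed
qed

text \<open>Multiply by the constant 1, regarded as having degree bound
  \<open>E - D\<close>.\<close>

lemma poly_fun_mono:
  assumes "finite Z" "poly_fun Z D f" "D \<le> E"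
  shows "poly_fun Z E f"
  using poly_fun_mult[OF assms(1,2) poly_fun_const[OF assms(1), of "E - D" 1]] assms(3) by simp

lemma poly_fun_prod:
  assumes "finite Z" "finite W" "\<And>i. i \<in> W \<Longrightarrow> poly_fun Z D (g i)"
  shows "poly_fun Z (card W * D) (\<lambda>x. \<Prod>i\<in>W. g i x)"
  using assms(2,3)
  by (induction W rule: finite_induct)
    (simp_all add: poly_fun_const[OF assms(1)] poly_fun_mult[OF assms(1)])

text \<open>In the Leibniz formula each term is a signed product of \<open>k\<close> entries, each
  of degree at most 1 in every variable.\<close>

lemma poly_fun_det:
  assumes "finite Z" "\<And>i j. i < k \<Longrightarrow> j < k \<Longrightarrow> poly_fun Z 1 (h i j)"
  shows "poly_fun Z k (\<lambda>x. det (mat k k (\<lambda>(i, j). h i j x)))"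
proof -
  have "det (mat k k (\<lambda>(i, j). h i j x)) =
    (\<Sum>p\<in>{p. p permutes {0..<k}}. signof p * (\<Prod>i\<in>{0..<k}. h i (p i) x))" for x
    by (subst det_def'[of _ k]) (auto intro!: sum.cong prod.cong dest: permutes_in_image)
  moreover have "poly_fun Z k (\<lambda>x. \<Prod>i\<in>{0..<k}. h i (p i) x)" if "p permutes {0..<k}" for p
  proof -
    have "poly_fun Z (card {0..<k} * 1) (\<lambda>x. \<Prod>i\<in>{0..<k}. h i (p i) x)"
    proof (intro poly_fun_prod assms)
      fix i assume "i \<in> {0..<k}"
      then show "i < k" "p i < k" using permutes_in_image[OF that, of i] by auto
    qed auto
    then show ?thesis by simp
  qed
  ultimately show ?thesis by (simp only:, intro poly_fun_sum poly_fun_cmult) auto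
qed

text \<open>An entry of the adjugate is a signed minor of order \<open>k - 1\<close>;
  \<open>?s\<close> is the index shift that skips the deleted row or column.\<close>

lemma poly_fun_adj_mat:
  assumes "finite Z" "\<And>i j. i < k \<Longrightarrow> j < k \<Longrightarrow> poly_fun Z 1 (h i j)" "p < k" "q < k"
  shows "poly_fun Z (k - 1) (\<lambda>x. adj_mat (mat k k (\<lambda>(i, j). h i j x)) $$ (p, q))"
proof -
  let ?s = "\<lambda>q i. if i < q then i else Suc i"
  have "adj_mat (mat k k (\<lambda>(i, j). h i j x)) $$ (p, q) =
    (-1) ^ (q + p) * det (mat (k - 1) (k - 1) (\<lambda>(i, j). h (?s q i) (?s p j) x))" for x
    using assms(3,4) unfolding adj_mat_def cofactor_def mat_delete_def
    by (auto intro!: arg_cong[where f = det] eq_matI)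
  moreover have "poly_fun Z (k - 1) (\<lambda>x. (-1) ^ (q + p) * det (mat (k - 1) (k - 1) (\<lambda>(i, j). h (?s q i) (?s p j) x)))"
    by (intro poly_fun_cmult poly_fun_det assms(1,2)) auto
  ultimately show ?thesis by simp
qed

section \<open>Zero patterns of symmetric matrices of low rank\<close>

text \<open>The argument of Ronyai, Babai and Ganapathy: the product of the polynomials indexed by W does not
  vanish at the witness of a pattern W' iff W is contained in W', so by triangularity these products
  are linearly independent.\<close>

lemma card_zero_patterns_le:
  fixes g :: "'i \<Rightarrow> ('z \<Rightarrow> real) \<Rightarrow> real"
  assumes "finite Z" "finite P" "\<And>i. i \<in> P \<Longrightarrow> poly_fun Z D (g i)"
    and wit: "\<And>W. W \<in> \<W> \<Longrightarrow> W \<subseteq> P \<and> (\<exists>x. \<forall>i\<in>P. i \<in> W \<longleftrightarrow> g i x \<noteq> 0)"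
  shows "card \<W> \<le> (card P * D + 1) ^ card Z"
proof (rule ccontr)
  assume contr: "\<not> card \<W> \<le> (card P * D + 1) ^ card Z"
  let ?A = "Z \<rightarrow>\<^sub>E {..card P * D}"
  define f where "f W x = (\<Prod>i\<in>W. g i x)" for W x
  have fin: "finite \<W>" using wit assms(2) by (intro finite_subset[of \<W> "Pow P"]) auto
  have "\<exists>x. \<forall>i\<in>P. i \<in> W \<longleftrightarrow> g i x \<noteq> 0" if "W \<in> \<W>" for W using wit[OF that] by blast
  then obtain w where w: "\<And>W i. W \<in> \<W> \<Longrightarrow> i \<in> P \<Longrightarrow> i \<in> W \<longleftrightarrow> g i (w W) \<noteq> 0" by metis
  have "poly_fun Z (card P * D) (f W)" if "W \<in> \<W>" for W
  proof (rule poly_fun_mono[OF assms(1)])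
    have W: "W \<subseteq> P" "finite W" using wit[OF that] assms(2) finite_subset by blast+
    then show "poly_fun Z (card W * D) (f W)"
      unfolding f_def by (intro poly_fun_prod assms(1,3)) auto
    show "card W * D \<le> card P * D" using W assms(2) by (intro mult_le_mono1 card_mono)
  qed
  then obtain c where c: "\<And>W x. W \<in> \<W> \<Longrightarrow> f W x = (\<Sum>\<alpha>\<in>?A. c W \<alpha> * (\<Prod>z\<in>Z. x z ^ \<alpha> z))"
    unfolding poly_fun_def by metis
  have "card ?A = (card P * D + 1) ^ card Z" using assms(1) by (simp add: card_PiE)
  moreover have "finite ?A" using assms(1) by (intro finite_PiE) auto
  \<comment> \<open>There are more patterns than monomials, so the coefficient vectors of the
    products \<open>f W\<close> are linearly dependent.\<close>
  ultimately obtain y where y: "\<exists>W\<in>\<W>. y W \<noteq> 0" "\<And>\<alpha>. \<alpha> \<in> ?A \<Longrightarrow> (\<Sum>W\<in>\<W>. y W * c W \<alpha>) = 0"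
    using homogeneous_system_nontrivial[of ?A \<W> c] fin contr by auto
  have zero: "(\<Sum>W\<in>\<W>. y W * f W x) = 0" for x
  proof -
    have "(\<Sum>W\<in>\<W>. y W * f W x) = (\<Sum>W\<in>\<W>. \<Sum>\<alpha>\<in>?A. y W * c W \<alpha> * (\<Prod>z\<in>Z. x z ^ \<alpha> z))"
      by (intro sum.cong refl) (simp add: c sum_distrib_left mult.assoc)
    also have "\<dots> = (\<Sum>\<alpha>\<in>?A. (\<Sum>W\<in>\<W>. y W * c W \<alpha>) * (\<Prod>z\<in>Z. x z ^ \<alpha> z))"
      by (subst sum.swap) (simp add: sum_distrib_right)
    finally show ?thesis using y(2) by simp
  qed
  have "finite {W\<in>\<W>. y W \<noteq> 0}" "{W\<in>\<W>. y W \<noteq> 0} \<noteq> {}" using fin y(1) by auto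
  \<comment> \<open>\<open>W0\<close> is inclusion-minimal among the patterns with nonzero
    coefficient. Any other such pattern contains an index outside \<open>W0\<close>, whose
    polynomial vanishes at the witness of \<open>W0\<close>, so only the term of \<open>W0\<close>
    survives there.\<close>
  then obtain W0 where W0: "W0 \<in> \<W>" "y W0 \<noteq> 0"
      "\<And>W. W \<in> \<W> \<Longrightarrow> y W \<noteq> 0 \<Longrightarrow> W \<subseteq> W0 \<Longrightarrow> W = W0"
    using finite_has_minimal[of "{W\<in>\<W>. y W \<noteq> 0}"] by blast
  have vanish: "y W * f W (w W0) = 0" if "W \<in> \<W> - {W0}" for W
  proof (cases "y W = 0")
    case False
    then obtain i where i: "i \<in> W" "i \<notin> W0" using W0 \<open>W \<in> \<W> - {W0}\<close> by blast
    moreover have "W \<subseteq> P" using wit that by blast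
    ultimately have "g i (w W0) = 0" "finite W" using w[OF W0(1), of i] assms(2) finite_subset by blast+
    then show ?thesis using i by (auto simp: f_def)
  qed simp
  have "(\<Sum>W\<in>\<W>. y W * f W (w W0)) = y W0 * f W0 (w W0) + (\<Sum>W\<in>\<W> - {W0}. y W * f W (w W0))"
    using fin W0(1) by (rule sum.remove)
  also have "(\<Sum>W\<in>\<W> - {W0}. y W * f W (w W0)) = 0" using vanish by (intro sum.neutral) blast
  finally have "f W0 (w W0) = 0" using zero W0(2) by simp
  moreover have "W0 \<subseteq> P" "finite W0" using wit[OF W0(1)] assms(2) finite_subset by blast+
  ultimately show False using w[OF W0(1)] unfolding f_def by (auto simp: prod_zero_iff)
qed

text \<open>Z is the set of nonzero positions in a row basis. No row of interest vanishes on S, because the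
  diagonal is nonzero there, so the basis can be read off as the first projection of Z.\<close>

definition sym_patterns :: "'a set \<Rightarrow> ('a \<times> 'a) set \<Rightarrow> ('a \<times> 'a) set set" where
  "sym_patterns S Z = {W. \<exists>M. (\<forall>i\<in>S. \<forall>j\<in>S. M i j = M j i) \<and> rows_indep M S (fst ` Z) \<and>
     (\<forall>i\<in>S. row_in_span M S (fst ` Z) i) \<and>
     Z = {(b, j)\<in>fst ` Z \<times> S. M b j \<noteq> 0} \<and> W = {(i, j)\<in>S \<times> S. M i j \<noteq> 0}}"

text \<open>A kernel vector of the core, read as coefficients of the basis rows, gives a combination
  vanishing on the columns in \<open>B\<close>. By symmetry column j is row j, a combination of
  basis rows, so it vanishes on all of \<open>S\<close>, against independence.\<close>

lemma det_core_nonzero: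
  assumes "bij_betw e {0..<k} B" "B \<subseteq> S" "rows_indep M S B"
    and span: "\<And>i. i \<in> S \<Longrightarrow> row_in_span M S B i" and sym: "\<And>i j. i \<in> S \<Longrightarrow> j \<in> S \<Longrightarrow> M i j = M j i"
  shows "det (mat k k (\<lambda>(p, q). M (e p) (e q))) \<noteq> 0"
proof
  let ?K = "mat k k (\<lambda>(p, q). M (e p) (e q))"
  assume "det ?K = 0"
  then obtain v where v: "v \<in> carrier_vec k" "v \<noteq> 0\<^sub>v k" "?K *\<^sub>v v = 0\<^sub>v k"
    using det_0_iff_vec_prod_zero[of ?K k] by auto
  define x where "x b = v $ (the_inv_into {0..<k} e b)" for b
  have inj: "inj_on e {0..<k}" using assms(1) by (simp add: bij_betw_def)
  have xe: "x (e q) = v $ q" if "q < k" for q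
    using that by (simp add: x_def the_inv_into_f_f[OF inj])
  have ker: "(\<Sum>b\<in>B. x b * M a b) = 0" if a: "a \<in> B" for a
  proof -
    obtain p where p: "p < k" "a = e p" using assms(1) a by (auto simp: bij_betw_def)
    have "(\<Sum>b\<in>B. x b * M a b) = (\<Sum>q\<in>{0..<k}. x (e q) * M a (e q))"
      using sum.reindex_bij_betw[OF assms(1), of "\<lambda>b. x b * M a b"] by simp
    also have "\<dots> = (\<Sum>q\<in>{0..<k}. M (e p) (e q) * v $ q)"
      using p by (intro sum.cong) (auto simp: xe mult.commute)
    also have "\<dots> = (?K *\<^sub>v v) $ p"
      using p v(1) by (auto simp: scalar_prod_def intro!: sum.cong)
    also have "\<dots> = 0" using v(3) p by simp
    finally show ?thesis .
  qed
  have "(\<Sum>b\<in>B. x b * M b j) = 0" if j: "j \<in> S" for j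
  proof -
    obtain c where c: "\<And>i. i \<in> S \<Longrightarrow> M j i = (\<Sum>a\<in>B. c a * M a i)"
      using span[OF j] unfolding row_in_span_def by blast
    have "(\<Sum>b\<in>B. x b * M b j) = (\<Sum>b\<in>B. \<Sum>a\<in>B. c a * (x b * M a b))"
    proof (intro sum.cong refl)
      fix b assume "b \<in> B"
      then have "M b j = (\<Sum>a\<in>B. c a * M a b)" using c[of b] sym[of b j] j assms(2) by auto
      then show "x b * M b j = (\<Sum>a\<in>B. c a * (x b * M a b))" by (simp add: sum_distrib_left mult_ac)
    qed
    also have "\<dots> = (\<Sum>a\<in>B. c a * (\<Sum>b\<in>B. x b * M a b))"
      by (subst sum.swap) (simp add: sum_distrib_left)
    finally show ?thesis using ker by simp
  qed
  then have "\<forall>a\<in>B. x a = 0" using assms(3) unfolding rows_indep_def by blast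
  then have "v $ q = 0" if "q < k" for q
    using xe[OF that] that assms(1) by (force simp: bij_betw_def)
  then have "v = 0\<^sub>v k" using v(1) by (intro eq_vecI) auto
  with v(2) show False by contradiction
qed

text \<open>Division-free Cramer's rule: every entry is, up to the factor det K, a polynomial in the entries
  of the basis rows.\<close>

lemma entry_times_det_core:
  assumes "bij_betw e {0..<k} B" "B \<subseteq> S" and "i \<in> S" "j \<in> S"
    and span: "\<And>i. i \<in> S \<Longrightarrow> row_in_span M S B i" and sym: "\<And>i j. i \<in> S \<Longrightarrow> j \<in> S \<Longrightarrow> M i j = M j i"
  defines "K \<equiv> mat k k (\<lambda>(p, q). M (e p) (e q))"
  shows "(\<Sum>q\<in>{0..<k}. \<Sum>p\<in>{0..<k}. M (e p) i * adj_mat K $$ (p, q) * M (e q) j) = det K * M i j"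
proof -
  have K: "K \<in> carrier_mat k k" by (simp add: K_def)
  have eS: "e p \<in> S" if "p < k" for p using assms(1,2) that by (auto simp: bij_betw_def)
  have KA: "(\<Sum>p\<in>{0..<k}. K $$ (r, p) * adj_mat K $$ (p, q)) = (if r = q then det K else 0)"
    if "r < k" "q < k" for r q
  proof -
    have "(\<Sum>p\<in>{0..<k}. K $$ (r, p) * adj_mat K $$ (p, q)) = (K * adj_mat K) $$ (r, q)"
      using that K adj_mat(1)[OF K] by (auto simp: scalar_prod_def intro!: sum.cong)
    then show ?thesis using that by (simp add: adj_mat(2)[OF K])
  qed
  obtain c0 where "\<And>j. j \<in> S \<Longrightarrow> M i j = (\<Sum>a\<in>B. c0 a * M a j)"
    using span[OF \<open>i \<in> S\<close>] unfolding row_in_span_def by blast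
  then have c: "M i j = (\<Sum>r\<in>{0..<k}. c0 (e r) * M (e r) j)" if "j \<in> S" for j
    using that sum.reindex_bij_betw[OF assms(1), of "\<lambda>a. c0 a * M a j"] by simp
  \<comment> \<open>By symmetry \<open>M (e p) i\<close> is \<open>M i (e p)\<close>, hence the
    coefficient vector \<open>c0\<close> times column p of \<open>K\<close>; multiplying by the
    adjugate returns \<open>c0\<close> scaled by \<open>det K\<close>.\<close>
  have inner: "(\<Sum>p\<in>{0..<k}. M (e p) i * adj_mat K $$ (p, q)) = det K * c0 (e q)" if q: "q < k" for q
  proof -
    have "(\<Sum>p\<in>{0..<k}. M (e p) i * adj_mat K $$ (p, q)) =
      (\<Sum>p\<in>{0..<k}. \<Sum>r\<in>{0..<k}. c0 (e r) * (K $$ (r, p) * adj_mat K $$ (p, q)))"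
    proof (intro sum.cong refl)
      fix p assume p: "p \<in> {0..<k}"
      then have "M (e p) i = (\<Sum>r\<in>{0..<k}. c0 (e r) * K $$ (r, p))"
        using c[of "e p"] eS[of p] sym[of i "e p"] \<open>i \<in> S\<close> by (simp add: K_def)
      then show "M (e p) i * adj_mat K $$ (p, q) =
          (\<Sum>r\<in>{0..<k}. c0 (e r) * (K $$ (r, p) * adj_mat K $$ (p, q)))"
        by (simp add: sum_distrib_right mult.assoc)
    qed
    also have "\<dots> = (\<Sum>r\<in>{0..<k}. c0 (e r) * (\<Sum>p\<in>{0..<k}. K $$ (r, p) * adj_mat K $$ (p, q)))"
      by (subst sum.swap) (simp add: sum_distrib_left)
    also have "\<dots> = (\<Sum>r\<in>{0..<k}. if r = q then c0 (e r) * det K else 0)"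
      using q by (intro sum.cong) (auto simp: KA)
    finally show ?thesis using q by (simp add: mult.commute)
  qed
  have "(\<Sum>q\<in>{0..<k}. \<Sum>p\<in>{0..<k}. M (e p) i * adj_mat K $$ (p, q) * M (e q) j) =
    (\<Sum>q\<in>{0..<k}. det K * (c0 (e q) * M (e q) j))"
    by (intro sum.cong refl) (simp add: sum_distrib_right[symmetric] inner)
  also have "\<dots> = det K * M i j" using c[OF \<open>j \<in> S\<close>] by (simp add: sum_distrib_left)
  finally show ?thesis .
qed

text \<open>One variable per position of \<open>Z\<close>; \<open>y\<close> puts 0 at the other
  positions of the basis rows. Evaluated at the entries of a witness \<open>M\<close>, the
  polynomial \<open>g (i, j)\<close> is the nonzero number \<open>det K\<close> times
  \<open>M i j\<close>, so each pattern is the nonvanishing pattern of the family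
  \<open>g\<close>.\<close>

lemma card_sym_patterns_le:
  assumes "finite S" "Z \<subseteq> S \<times> S"
  shows "card (sym_patterns S Z) \<le> (card (S \<times> S) * (card S + 1) + 1) ^ card Z"
proof -
  let ?B = "fst ` Z"
  have BS: "?B \<subseteq> S" using assms by auto
  have finZ: "finite Z" using assms finite_subset by blast
  define k where "k = card ?B"
  have kS: "k \<le> card S" unfolding k_def using assms BS by (intro card_mono)
  obtain e where e: "bij_betw e {0..<k} ?B"
    unfolding k_def using ex_bij_betw_nat_finite finZ by blast
  define y :: "('a \<times> 'a \<Rightarrow> real) \<Rightarrow> 'a \<Rightarrow> 'a \<Rightarrow> real" where
    "y x b j = (if (b, j) \<in> Z then x (b, j) else 0)" for x b j
  define K where "K x = mat k k (\<lambda>(p, q). y x (e p) (e q))" for x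
  define g where "g = (\<lambda>(i, j) x. \<Sum>q\<in>{0..<k}. \<Sum>p\<in>{0..<k}.
    y x (e p) i * adj_mat (K x) $$ (p, q) * y x (e q) j)"
  have y: "poly_fun Z 1 (\<lambda>x. y x b j)" for b j
    by (cases "(b, j) \<in> Z") (simp_all add: y_def poly_fun_var[OF finZ] poly_fun_zero del: One_nat_def)
  have g: "poly_fun Z (card S + 1) (g ij)" for ij
  proof -
    have "poly_fun Z (card S + 1) (\<lambda>x. y x (e p) i * adj_mat (K x) $$ (p, q) * y x (e q) j)"
      if "p < k" "q < k" for p q i j
    proof (rule poly_fun_mono[OF finZ])
      \<comment> \<open>Two entries and one cofactor: the degree bound is \<open>k + 1\<close>,
        since \<open>p < k\<close> makes \<open>k\<close> positive and the subtraction
        exact.\<close>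
      show "poly_fun Z (1 + (k - 1) + 1) (\<lambda>x. y x (e p) i * adj_mat (K x) $$ (p, q) * y x (e q) j)"
        unfolding K_def using that by (intro poly_fun_mult finZ y poly_fun_adj_mat)
    qed (use kS that in simp)
    then show ?thesis unfolding g_def by (cases ij) (auto intro!: poly_fun_sum)
  qed
  show ?thesis
  proof (rule card_zero_patterns_le[OF finZ _ g])
    fix W assume "W \<in> sym_patterns S Z"
    then obtain M where M: "\<And>i j. i \<in> S \<Longrightarrow> j \<in> S \<Longrightarrow> M i j = M j i" "rows_indep M S ?B"
      "\<And>i. i \<in> S \<Longrightarrow> row_in_span M S ?B i"
      "Z = {(b, j)\<in>?B \<times> S. M b j \<noteq> 0}" "W = {(i, j)\<in>S \<times> S. M i j \<noteq> 0}"
      unfolding sym_patterns_def by blast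
    let ?x = "\<lambda>(b, j). M b j"
    have yM: "y ?x b j = M b j" if "b \<in> ?B" "j \<in> S" for b j
    proof (cases "(b, j) \<in> Z")
      case False
      then have "M b j = 0" using that M(4) by blast
      then show ?thesis using False by (simp add: y_def)
    qed (simp add: y_def)
    have eB: "e p \<in> ?B" if "p < k" for p using e that by (auto simp: bij_betw_def)
    have K: "K ?x = mat k k (\<lambda>(p, q). M (e p) (e q))"
      unfolding K_def using eB BS by (intro eq_matI) (auto simp: yM subset_iff)
    have "g (i, j) ?x = det (K ?x) * M i j" if ij: "i \<in> S" "j \<in> S" for i j
    proof -
      have "g (i, j) ?x = (\<Sum>q\<in>{0..<k}. \<Sum>p\<in>{0..<k}. M (e p) i * adj_mat (K ?x) $$ (p, q) * M (e q) j)"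
        unfolding g_def using eB ij by (auto simp: yM intro!: sum.cong)
      then show ?thesis unfolding K using entry_times_det_core[OF e BS ij M(3,1)] by simp
    qed
    moreover have "det (K ?x) \<noteq> 0" unfolding K by (rule det_core_nonzero[OF e BS M(2,3,1)])
    ultimately have "\<forall>ij\<in>S \<times> S. ij \<in> W \<longleftrightarrow> g ij ?x \<noteq> 0" using M(5) by auto
    then show "W \<subseteq> S \<times> S \<and> (\<exists>x. \<forall>ij\<in>S \<times> S. ij \<in> W \<longleftrightarrow> g ij x \<noteq> 0)" using M(5) by blast
  qed (use assms(1) in simp)
qed

text \<open>On a balanced \<open>S\<close> of rank r, summing the row support bound over all rows
  gives |S|^2 \<le> r |W|, and the sparse basis gives |S| |Z| \<le> r |W|. Both pass from r and
  \<open>S\<close> to \<open>k\<close> and \<open>V\<close> by r |V| \<le> k |S|.\<close>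

lemma exists_sparse_sym_pattern:
  assumes "finite V" "V \<noteq> {}" and sym: "\<And>i j. M i j = M j i" and diag: "\<And>i. i \<in> V \<Longrightarrow> M i i \<noteq> 0"
    and rank: "principal_rank M V \<le> k"
  obtains S W Z where "S \<subseteq> V" "S \<noteq> {}" "W = {(i, j)\<in>S \<times> S. M i j \<noteq> 0}" "Z \<subseteq> S \<times> S"
    "W \<in> sym_patterns S Z" "card Z * card V \<le> k * card W" "card S * card V \<le> k * card W"
proof -
  obtain S where S: "S \<subseteq> V" "S \<noteq> {}" "rank_balanced M S"
    "principal_rank M S * card V \<le> principal_rank M V * card S"
    using exists_rank_balanced[OF assms(1,2)] .
  have fin: "finite S" using S assms finite_subset by blast
  define s where "s i = card {j\<in>S. M i j \<noteq> 0}" for i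
  define W where "W = {(i, j)\<in>S \<times> S. M i j \<noteq> 0}"
  obtain B where B: "B \<subseteq> S" "rows_indep M S B" "\<And>i. i \<in> S \<Longrightarrow> row_in_span M S B i"
    "card S * (\<Sum>b\<in>B. s b) \<le> principal_rank M S * (\<Sum>i\<in>S. s i)"
    using rank_balanced_sparse_basis[OF fin S(3), of s] by metis
  define Z where "Z = {(b, j)\<in>B \<times> S. M b j \<noteq> 0}"
  have card: "card {(b, j)\<in>A \<times> S. M b j \<noteq> 0} = (\<Sum>b\<in>A. s b)" if "A \<subseteq> S" for A
  proof -
    have "{(b, j)\<in>A \<times> S. M b j \<noteq> 0} = Sigma A (\<lambda>b. {j\<in>S. M b j \<noteq> 0})" by auto
    then show ?thesis using fin that finite_subset[of A S] by (simp add: card_SigmaI s_def)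
  qed
  have fstZ: "fst ` Z = B" using B(1) S(1) diag by (force simp: Z_def image_iff)
  let ?r = "principal_rank M S"
  have pos: "card S > 0" using S(2) fin by (simp add: card_gt_0_iff)
  have r: "?r * card V \<le> k * card S"
    using S(4) mult_le_mono1[OF rank] by (rule order_trans)
  have cW: "card W = (\<Sum>i\<in>S. s i)" unfolding W_def by (rule card) simp
  have cZ: "card S * card Z \<le> ?r * card W" using B(4) card[OF B(1)] cW by (simp add: Z_def)
  have "card S * card S = (\<Sum>i\<in>S. card S)" by simp
  also have "\<dots> \<le> (\<Sum>i\<in>S. ?r * s i)"
    unfolding s_def using rank_balanced_row_support[OF fin S(3)] diag S(1) by (intro sum_mono) auto
  also have "\<dots> = ?r * card W" by (simp add: cW sum_distrib_left)
  finally have cS: "card S * card S \<le> ?r * card W" .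
  have scale: "a * card V \<le> k * card W" if "card S * a \<le> ?r * card W" for a
  proof -
    have "card S * (a * card V) \<le> ?r * card W * card V"
      using mult_le_mono1[OF that, of "card V"] by (simp add: mult.assoc)
    also have "\<dots> \<le> k * card S * card W"
      using mult_le_mono1[OF r, of "card W"] by (simp add: mult_ac)
    finally have "card S * (a * card V) \<le> card S * (k * card W)" by (simp add: mult_ac)
    then show ?thesis using pos by simp
  qed
  have "W \<in> sym_patterns S Z"
    unfolding sym_patterns_def using B(2,3) sym by (intro CollectI exI[of _ M]) (auto simp: fstZ W_def, auto simp: Z_def)
  then show thesis
    using that[of S W Z] S(1,2) W_def scale[OF cZ] scale[OF cS] B(1) by (auto simp: Z_def)
qed

section \<open>The union bound\<close>

text \<open>A nonempty set of size at most \<open>Suc N\<close> arises by inserting an element of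
  \<open>A\<close> into a set of size at most \<open>N\<close>.\<close>

lemma card_bounded_subsets_le:
  assumes "finite A"
  shows "card {Z. Z \<subseteq> A \<and> card Z \<le> N} \<le> (card A + 1) ^ N"
proof (induction N)
  case 0
  have "Z = {}" if "Z \<subseteq> A" "card Z \<le> 0" for Z
    using that finite_subset[OF that(1) assms] by simp
  then have "{Z. Z \<subseteq> A \<and> card Z \<le> 0} \<subseteq> {{}}" by blast
  from card_mono[OF _ this] show ?case by simp
next
  case (Suc N)
  let ?F = "{Z. Z \<subseteq> A \<and> card Z \<le> N}"
  have fin: "finite ?F" using assms by simp
  have "{Z. Z \<subseteq> A \<and> card Z \<le> Suc N} \<subseteq> ?F \<union> (\<lambda>(a, Z). insert a Z) ` (A \<times> ?F)"
  proof
    fix Z assume "Z \<in> {Z. Z \<subseteq> A \<and> card Z \<le> Suc N}"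
    then have Z: "Z \<subseteq> A" "card Z \<le> Suc N" by auto
    show "Z \<in> ?F \<union> (\<lambda>(a, Z). insert a Z) ` (A \<times> ?F)"
    proof (cases "Z = {}")
      case False
      then obtain a where a: "a \<in> Z" by blast
      have "card (Z - {a}) \<le> N" using Z a assms finite_subset[of Z A] by simp
      then have "(a, Z - {a}) \<in> A \<times> ?F" "Z = insert a (Z - {a})" using Z a by auto
      then show ?thesis by blast
    qed simp
  qed
  then have "card {Z. Z \<subseteq> A \<and> card Z \<le> Suc N} \<le> card (?F \<union> (\<lambda>(a, Z). insert a Z) ` (A \<times> ?F))"
    using fin assms by (intro card_mono) auto
  also have "\<dots> \<le> card ?F + card (A \<times> ?F)"
    using fin assms by (intro order_trans[OF card_Un_le] add_left_mono card_image_le) auto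
  also have "\<dots> = (card A + 1) * card ?F" by (simp add: card_cartesian_product)
  also have "\<dots> \<le> (card A + 1) * (card A + 1) ^ N" using Suc by (rule mult_le_mono2)
  also have "\<dots> = (card A + 1) ^ Suc N" by simp
  finally show ?case .
qed

text \<open>These pairs have to be non-edges when \<open>W\<close> is the support of a matrix
  vanishing on the edges.\<close>

definition offdiag_edges :: "(nat \<times> nat) set \<Rightarrow> nat set set" where
  "offdiag_edges W = {e. \<exists>i j. (i, j) \<in> W \<and> i \<noteq> j \<and> e = {i, j}}"

text \<open>At most \<open>card S\<close> positions are diagonal, and each unordered pair comes from
  at most two ordered ones.\<close>

lemma card_le_offdiag_edges:
  assumes "finite S" "W \<subseteq> S \<times> S"
  shows "card W \<le> card S + 2 * card (offdiag_edges W)"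
proof -
  let ?F = "offdiag_edges W"
  define fib :: "nat set \<Rightarrow> (nat \<times> nat) set" where "fib e = {(i, j). e = {i, j} \<and> i \<noteq> j}" for e
  have "?F \<subseteq> Pow S" using assms(2) unfolding offdiag_edges_def by blast
  then have fin: "finite ?F" by (rule finite_subset) (use assms(1) in simp)
  have fib: "finite (fib e) \<and> card (fib e) \<le> 2" if "e \<in> ?F" for e
  proof -
    obtain a b where e: "e = {a, b}" using \<open>e \<in> ?F\<close> unfolding offdiag_edges_def by blast
    have sub: "fib e \<subseteq> {(a, b), (b, a)}"
    proof (rule subrelI)
      fix i j assume "(i, j) \<in> fib e"
      then have "{a, b} = {i, j}" unfolding fib_def e by simp
      then show "(i, j) \<in> {(a, b), (b, a)}" by (auto simp: doubleton_eq_iff)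
    qed
    have "card (fib e) \<le> card {(a, b), (b, a)}" by (rule card_mono[OF _ sub]) simp
    also have "\<dots> \<le> 2" using card_length[of "[(a, b), (b, a)]"] by simp
    finally show ?thesis using finite_subset[OF sub] by simp
  qed
  have "W \<subseteq> (\<lambda>i. (i, i)) ` S \<union> (\<Union>e\<in>?F. fib e)"
  proof (rule subrelI)
    fix i j assume ij: "(i, j) \<in> W"
    show "(i, j) \<in> (\<lambda>i. (i, i)) ` S \<union> (\<Union>e\<in>?F. fib e)"
    proof (cases "i = j")
      case True
      then show ?thesis using ij assms(2) by blast
    next
      case False
      then have "{i, j} \<in> ?F" using ij unfolding offdiag_edges_def by blast
      moreover have "(i, j) \<in> fib {i, j}" using False by (simp add: fib_def)
      ultimately show ?thesis by blast
    qed
  qed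
  then have "card W \<le> card ((\<lambda>i. (i, i)) ` S \<union> (\<Union>e\<in>?F. fib e))"
    by (rule card_mono[rotated]) (use fin fib assms(1) in simp)
  also have "\<dots> \<le> card ((\<lambda>i. (i, i)) ` S) + card (\<Union>e\<in>?F. fib e)" by (rule card_Un_le)
  also have "\<dots> \<le> card S + (\<Sum>e\<in>?F. card (fib e))"
    by (rule add_mono[OF card_image_le[OF assms(1)] card_UN_le[OF fin]])
  also have "\<dots> \<le> card S + (\<Sum>e\<in>?F. 2)" using fib by (intro add_left_mono sum_mono) simp
  finally show ?thesis by simp
qed

text \<open>Expanding the square writes each row as a combination of d + 2 fixed vectors: the
  constant 1 (index 0), the negated squared norms (index 1) and the d coordinates, doubled (indices
  from 2 on).\<close>

lemma principal_rank_unit_distance_le: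
  fixes u :: "nat \<Rightarrow> nat \<Rightarrow> real"
  assumes "finite V"
  shows "principal_rank (\<lambda>i j. 1 - (\<Sum>k<d. (u i k - u j k)\<^sup>2)) V \<le> d + 2"
proof -
  let ?M = "\<lambda>i j. 1 - (\<Sum>k<d. (u i k - u j k)\<^sup>2)"
  obtain J where J: "J \<subseteq> V" "rows_indep ?M V J" "card J = principal_rank ?M V"
    using principal_rank_attained[OF assms] .
  define c where "c i b = (if b = 0 then 1 - (\<Sum>k<d. (u i k)\<^sup>2) else if b = 1 then 1 else u i (b - 2))" for i b
  define v where "v b j = (if b = 0 then 1 else if b = 1 then - (\<Sum>k<d. (u j k)\<^sup>2) else 2 * u j (b - 2))" for b j
  have eq: "?M i j = (\<Sum>b<Suc (Suc d). c i b * v b j)" for i j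
  proof -
    have "(\<Sum>b<Suc (Suc d). c i b * v b j) = c i 0 * v 0 j + (c i 1 * v 1 j + (\<Sum>k<d. c i (Suc (Suc k)) * v (Suc (Suc k)) j))"
      by (simp add: sum.lessThan_Suc_shift del: sum.lessThan_Suc)
    also have "\<dots> = 1 - (\<Sum>k<d. (u i k)\<^sup>2) - (\<Sum>k<d. (u j k)\<^sup>2) + (\<Sum>k<d. 2 * u i k * u j k)"
      by (simp add: c_def v_def mult_ac)
    also have "\<dots> = ?M i j"
      by (simp add: power2_diff sum.distrib sum_subtractf)
    finally show ?thesis by simp
  qed
  have "card J \<le> card {..<Suc (Suc d)}"
    by (rule rows_indep_card_le[OF _ finite_subset[OF J(1) assms] J(2) eq]) simp
  then show ?thesis using J(3) by simp
qed

text \<open>\<open>k\<close> stands for the rank bound. The size \<open>s\<close> is a parameter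
  because both the number of patterns and the probability of a single one are estimated in terms of
  it.\<close>

definition sparse_patterns :: "nat \<Rightarrow> nat \<Rightarrow> nat set \<Rightarrow> nat \<Rightarrow> (nat \<times> nat) set set" where
  "sparse_patterns n k S s = {W. W \<subseteq> S \<times> S \<and> card W = s \<and> n * card S \<le> k * s \<and>
     (\<exists>Z\<subseteq>S \<times> S. W \<in> sym_patterns S Z \<and> card Z * n \<le> k * s)}"

lemma unit_distance_graph_avoids_pattern:
  assumes "unit_distance_graph d E" "n > 0"
  obtains S W where "S \<subseteq> {..<n}" "S \<noteq> {}" "W \<in> sparse_patterns n (d + 2) S (card W)"
    "E \<inter> offdiag_edges W = {}"
proof -
  obtain u where u: "\<And>i j. {i, j} \<in> E \<Longrightarrow> sqrt (\<Sum>k<d. (u i k - u j k)\<^sup>2) = 1"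
    using assms(1) unfolding unit_distance_graph_def by blast
  define M where "M i j = 1 - (\<Sum>k<d. (u i k - u j k)\<^sup>2)" for i j
  have edge: "M i j = 0" if "{i, j} \<in> E" for i j
    using u[OF that] by (simp add: M_def)
  have rank: "principal_rank M {..<n} \<le> d + 2"
    unfolding M_def[abs_def] by (rule principal_rank_unit_distance_le) simp
  obtain S W Z where S: "S \<subseteq> {..<n}" "S \<noteq> {}" and W: "W = {(i, j)\<in>S \<times> S. M i j \<noteq> 0}"
    and Z: "Z \<subseteq> S \<times> S" "W \<in> sym_patterns S Z" "card Z * card {..<n} \<le> (d + 2) * card W"
    and SW: "card S * card {..<n} \<le> (d + 2) * card W"
  proof (rule exists_sparse_sym_pattern[OF _ _ _ _ rank])
    show "M i j = M j i" for i j by (simp add: M_def power2_commute)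
  qed (use assms(2) in \<open>auto simp: M_def\<close>)
  have "W \<subseteq> S \<times> S" using W by auto
  moreover have "n * card S \<le> (d + 2) * card W" using SW by (simp add: mult.commute)
  moreover have "card Z * n \<le> (d + 2) * card W" using Z(3) by simp
  ultimately have "W \<in> sparse_patterns n (d + 2) S (card W)"
    unfolding sparse_patterns_def using Z(1,2) by blast
  moreover have "E \<inter> offdiag_edges W = {}"
    using edge W by (auto simp: offdiag_edges_def)
  ultimately show thesis using that S by blast
qed

text \<open>The exponent is 7 = 3 + 4: with N = k s div n there are at most (n^3)^N choices of Z,
  and each admits at most (n^4)^N patterns.\<close>

lemma card_sparse_patterns_le:
  assumes "n \<ge> 2" "S \<subseteq> {..<n}"
  shows "card (sparse_patterns n k S s) \<le> n ^ (7 * (k * s div n))"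
proof -
  have fin: "finite S" using assms finite_subset by blast
  have cS: "card S \<le> n" using card_mono[OF _ assms(2)] by simp
  let ?N = "k * s div n" and ?P = "{Z. Z \<subseteq> S \<times> S \<and> card Z \<le> k * s div n}"
  have c2: "card (S \<times> S) \<le> n ^ 2"
    using mult_mono[OF cS cS] by (simp add: card_cartesian_product power2_eq_square)
  have n2: "n ^ 2 + 1 \<le> n ^ 3"
  proof -
    have "2 * n ^ 2 \<le> n * n ^ 2" using assms(1) by (intro mult_le_mono1)
    moreover have "1 \<le> n ^ 2" using assms(1) by simp
    moreover have "n * n ^ 2 = n ^ 3" by (simp add: numeral_eq_Suc)
    ultimately show ?thesis by linarith
  qed
  have n3: "n ^ 2 * (n + 1) + 1 \<le> n ^ 4"
  proof -
    have "2 * n ^ 3 \<le> n * n ^ 3" using assms(1) by (intro mult_le_mono1)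
    moreover have "n * n ^ 3 = n ^ 4" "n ^ 2 * (n + 1) = n ^ 3 + n ^ 2" by (simp_all add: numeral_eq_Suc)
    ultimately show ?thesis using n2 by linarith
  qed
  have finP: "finite ?P" using fin by simp
  have finW: "finite (sym_patterns S Z)" for Z
    by (rule finite_subset[of _ "Pow (S \<times> S)"]) (use fin in \<open>auto simp: sym_patterns_def\<close>)
  have "sparse_patterns n k S s \<subseteq> (\<Union>Z\<in>?P. sym_patterns S Z)"
    using assms(1) by (auto simp: sparse_patterns_def less_eq_div_iff_mult_less_eq)
  then have "card (sparse_patterns n k S s) \<le> card (\<Union>Z\<in>?P. sym_patterns S Z)"
    using finP finW by (intro card_mono) auto
  also have "\<dots> \<le> (\<Sum>Z\<in>?P. card (sym_patterns S Z))" using finP by (rule card_UN_le)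
  also have "\<dots> \<le> (\<Sum>Z\<in>?P. (n ^ 4) ^ ?N)"
  proof (intro sum_mono)
    fix Z assume Z: "Z \<in> ?P"
    have "card (sym_patterns S Z) \<le> (card (S \<times> S) * (card S + 1) + 1) ^ card Z"
      using Z fin by (intro card_sym_patterns_le) auto
    also have "\<dots> \<le> (n ^ 4) ^ card Z"
      using mult_mono[OF c2, of "card S + 1" "n + 1"] cS n3 by (intro power_mono) auto
    also have "\<dots> \<le> (n ^ 4) ^ ?N" using Z assms(1) by (intro power_increasing) auto
    finally show "card (sym_patterns S Z) \<le> (n ^ 4) ^ ?N" .
  qed
  also have "\<dots> = card ?P * (n ^ 4) ^ ?N" by simp
  also have "\<dots> \<le> (n ^ 3) ^ ?N * (n ^ 4) ^ ?N"
  proof (intro mult_le_mono1)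
    have "card ?P \<le> (card (S \<times> S) + 1) ^ ?N" using fin by (intro card_bounded_subsets_le) auto
    also have "\<dots> \<le> (n ^ 3) ^ ?N" using c2 n2 by (intro power_mono) auto
    finally show "card ?P \<le> (n ^ 3) ^ ?N" .
  qed
  also have "\<dots> = n ^ (7 * ?N)" by (simp flip: power_mult power_add)
  finally show ?thesis .
qed

text \<open>The number of patterns is at most exp (7/64 L s). As s \<ge> 64 |S|, each weight is at
  most exp (- 63/128 L s). The product is at most exp (- 49/128 L s), and L s \<ge> 64 |S| ln n
  leaves room to spare over 16 |S| ln n.\<close>

lemma sparse_patterns_weight_le:
  fixes n k s :: nat and p L :: real
  assumes L_def: "L = - ln (1 - p)" and "n \<ge> 2" "k > 0" "0 < p" "p < 1" "64 * (k * ln n) \<le> n * L" "L \<le> ln n"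
    and S: "S \<subseteq> {..<n}"
  shows "(\<Sum>W\<in>sparse_patterns n k S s. (1 - p) ^ card (offdiag_edges W)) \<le> exp (- (16 * real (card S) * ln n))"
proof (cases "sparse_patterns n k S s = {}")
  case False
  then have low: "n * card S \<le> k * s" by (auto simp: sparse_patterns_def)
  have fin: "finite S" using S finite_subset by blast
  have lnn: "ln n > 0" using assms(2) by simp
  have L: "L > 0" using assms(4,5) by (simp add: L_def)
  have n: "real n > 0" "real k > 0" using assms(2,3) by auto
  have lowr: "real n * real (card S) \<le> real k * real s" using low by (metis of_nat_le_iff of_nat_mult)
  \<comment> \<open>Both hypotheses combine here: 64 k ln n \<le> n L \<le> n ln n.\<close>
  have k64: "64 * real k \<le> n"
  proof -
    have "64 * real k * ln n \<le> real n * ln n"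
      using assms(6) mult_left_mono[OF assms(7), of n] by simp
    then show ?thesis using lnn by simp
  qed
  have s64: "64 * real (card S) \<le> s"
  proof -
    have "real k * (64 * real (card S)) \<le> real n * real (card S)" using k64 mult_right_mono[of "64 * real k" n "card S"] by (simp add: mult_ac)
    also have "\<dots> \<le> real k * real s" by (rule lowr)
    finally show ?thesis using n by simp
  qed
  have Ls: "64 * real (card S) * ln n \<le> L * s"
  proof -
    have "real k * (64 * real (card S) * ln n) = 64 * (k * ln n) * card S" by simp
    also have "\<dots> \<le> (n * L) * card S" using assms(6) by (rule mult_right_mono) simp
    also have "\<dots> = L * (real n * real (card S))" by simp
    also have "\<dots> \<le> L * (real k * real s)" using lowr L by (intro mult_left_mono) auto
    finally have "real k * (64 * real (card S) * ln n) \<le> real k * (L * s)" by (simp add: mult_ac)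
    then show ?thesis using n by simp
  qed
  have N: "7 * real (k * s div n) * ln n \<le> 7 / 64 * (L * s)"
  proof -
    have "real n * real (k * s div n) \<le> real (k * s)"
      unfolding of_nat_mult[symmetric] of_nat_le_iff by (rule times_div_less_eq_dividend)
    then have "real (k * s div n) \<le> real (k * s) / n" using n by (simp add: pos_le_divide_eq mult.commute)
    then have "real (k * s div n) * ln n \<le> real (k * s) / n * ln n"
      using lnn by (intro mult_right_mono) auto
    also have "\<dots> = (k * ln n) * (s / n)" by simp
    also have "\<dots> \<le> (n * L / 64) * (s / n)"
      using assms(6) by (intro mult_right_mono) auto
    also have "\<dots> = L * s / 64" using n by simp
    finally show ?thesis by linarith
  qed
  have weight: "(1 - p) ^ card (offdiag_edges W) \<le> exp (- (L * (real s - real (card S)) / 2))"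
    if "W \<in> sparse_patterns n k S s" for W
  proof -
    have "W \<subseteq> S \<times> S" "card W = s" using that by (auto simp: sparse_patterns_def)
    then have "real s - real (card S) \<le> 2 * card (offdiag_edges W)"
      using card_le_offdiag_edges[OF fin, of W] by linarith
    then have "L * ((real s - card S) / 2) \<le> L * card (offdiag_edges W)"
      using L by (intro mult_left_mono) auto
    moreover have "(1 - p) ^ card (offdiag_edges W) = exp (- (L * card (offdiag_edges W)))"
      using assms(5) by (simp add: L_def mult.commute[of "ln _"] exp_of_nat_mult)
    ultimately show ?thesis by simp
  qed
  have "(\<Sum>W\<in>sparse_patterns n k S s. (1 - p) ^ card (offdiag_edges W))
      \<le> (\<Sum>W\<in>sparse_patterns n k S s. exp (- (L * (real s - real (card S)) / 2)))"
    using weight by (rule sum_mono)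
  also have "\<dots> = card (sparse_patterns n k S s) * exp (- (L * (real s - real (card S)) / 2))" by simp
  also have "\<dots> \<le> real (n ^ (7 * (k * s div n))) * exp (- (L * (real s - real (card S)) / 2))"
    using card_sparse_patterns_le[OF assms(2) S, of k s] by (intro mult_right_mono) (simp_all only: of_nat_le_iff exp_ge_zero)
  also have "real (n ^ (7 * (k * s div n))) = exp (7 * real (k * s div n) * ln n)"
  proof -
    have "exp (real (7 * (k * s div n)) * ln n) = exp (ln n) ^ (7 * (k * s div n))"
      by (rule exp_of_nat_mult)
    then show ?thesis using n by simp
  qed
  also have "\<dots> * exp (- (L * (real s - real (card S)) / 2)) = exp (7 * real (k * s div n) * ln n - L * (real s - real (card S)) / 2)"
    by (simp only: mult_exp_exp diff_conv_add_uminus)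
  also have "\<dots> \<le> exp (- (16 * real (card S) * ln n))"
  proof -
    have "L * (63 / 64 * s) \<le> L * (real s - real (card S))" using s64 L by (intro mult_left_mono) auto
    then have "63 / 128 * (L * s) \<le> L * (real s - real (card S)) / 2" by simp
    moreover have "0 \<le> L * s" using L by simp
    ultimately show ?thesis using N Ls by (simp add: algebra_simps)
  qed
  finally show ?thesis .
qed simp

lemma sum_Pow_power_card:
  fixes x :: real
  assumes "finite A"
  shows "(\<Sum>S\<in>Pow A. x ^ card S) = (1 + x) ^ card A"
proof -
  have "(1 + x) ^ card A = (\<Prod>a\<in>A. x + 1)" by (simp add: add.commute)
  also have "\<dots> = (\<Sum>S\<in>Pow A. (\<Prod>a\<in>S. x) * (\<Prod>a\<in>A - S. 1))" using assms by (rule prod_add)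
  finally show ?thesis by simp
qed

text \<open>Summing over s \<le> n^2, each nonempty S contributes at most (n^2 + 1) n^(-16 |S|),
  which is at most n^(-13 |S|) because n^2 + 1 \<le> n^3 and |S| \<ge> 1. By the binomial theorem
  these bounds sum to (1 + n^(-13))^n - 1.\<close>

lemma prob_unit_distance_graph_le:
  fixes n d :: nat and p :: real
  assumes n: "n \<ge> 2" and p: "0 < p" "p < 1"
    and d: "64 * (real (d + 2) * ln n) \<le> n * (- ln (1 - p))" and L: "- ln (1 - p) \<le> ln n"
  shows "gnp_prob n p (unit_distance_graph d) \<le> exp (n * exp (- (13 * ln n))) - 1"
proof -
  let ?V = "{..<n}" and ?C = "sparse_patterns n (d + 2)"
  have finC: "finite (?C S s)" if "S \<subseteq> ?V" for S s
    by (rule finite_subset[of _ "Pow (S \<times> S)"])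
      (use that finite_subset[of S ?V] in \<open>auto simp: sparse_patterns_def\<close>)
  have "of_bool (unit_distance_graph d E) \<le>
    (\<Sum>S\<in>Pow ?V - {{}}. \<Sum>s\<le>n^2. \<Sum>W\<in>?C S s. of_bool (E \<inter> offdiag_edges W = {}) :: real)" for E
  proof (cases "unit_distance_graph d E")
    case True
    then obtain S W where SW: "S \<subseteq> ?V" "S \<noteq> {}" "W \<in> ?C S (card W)" "E \<inter> offdiag_edges W = {}"
      using unit_distance_graph_avoids_pattern[of d E n] n by auto
    have "card S \<le> n" using card_mono[OF _ SW(1)] by simp
    moreover have "card W \<le> card (S \<times> S)"
      using SW(1,3) finite_subset[of S ?V] by (intro card_mono) (auto simp: sparse_patterns_def)
    ultimately have cW: "card W \<le> n^2"
      using mult_mono[of "card S" n "card S" n] by (simp add: card_cartesian_product power2_eq_square)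
    have "1 \<le> (\<Sum>W\<in>?C S (card W). of_bool (E \<inter> offdiag_edges W = {}) :: real)"
      using member_le_sum[of W "?C S (card W)" "\<lambda>W. of_bool (E \<inter> offdiag_edges W = {}) :: real"]
        SW finC by simp
    also have "\<dots> \<le> (\<Sum>s\<le>n^2. \<Sum>W\<in>?C S s. of_bool (E \<inter> offdiag_edges W = {}))"
      by (rule member_le_sum) (simp_all add: cW sum_nonneg)
    also have "\<dots> \<le> (\<Sum>S\<in>Pow ?V - {{}}. \<Sum>s\<le>n^2. \<Sum>W\<in>?C S s. of_bool (E \<inter> offdiag_edges W = {}))"
    proof (rule member_le_sum)
      show "S \<in> Pow ?V - {{}}" using SW(1,2) by blast
    qed (simp_all add: sum_nonneg)
    finally show ?thesis using True by simp
  qed (auto intro!: sum_nonneg)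
  then have "gnp_prob n p (unit_distance_graph d) \<le> rsub_expect p (all_pairs n)
     (\<lambda>E. \<Sum>S\<in>Pow ?V - {{}}. \<Sum>s\<le>n^2. \<Sum>W\<in>?C S s. of_bool (E \<inter> offdiag_edges W = {}))"
    unfolding gnp_prob_eq_expect using p by (intro rsub_expect_mono) auto
  also have "\<dots> = (\<Sum>S\<in>Pow ?V - {{}}. \<Sum>s\<le>n^2. \<Sum>W\<in>?C S s. (1 - p) ^ card (offdiag_edges W))"
    unfolding rsub_expect_sum
  proof (intro sum.cong refl rsub_prob_avoid finite_all_pairs)
    fix S s W assume "S \<in> Pow ?V - {{}}" "W \<in> ?C S s"
    then have "W \<subseteq> ?V \<times> ?V" by (auto simp: sparse_patterns_def)
    then show "offdiag_edges W \<subseteq> all_pairs n" by (auto simp: offdiag_edges_def all_pairs_def)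
  qed
  also have "\<dots> \<le> (\<Sum>S\<in>Pow ?V - {{}}. exp (- (13 * ln n)) ^ card S)"
  proof (intro sum_mono)
    fix S assume S: "S \<in> Pow ?V - {{}}"
    then have c1: "card S \<ge> 1" using finite_subset[of S ?V] by (auto simp: Suc_le_eq card_gt_0_iff)
    have lnn: "ln n > 0" using n by simp
    have "(\<Sum>s\<le>n^2. \<Sum>W\<in>?C S s. (1 - p) ^ card (offdiag_edges W))
      \<le> (\<Sum>s\<le>n^2. exp (- (16 * real (card S) * ln n)))"
      using S n p d L by (intro sum_mono sparse_patterns_weight_le[OF refl]) auto
    also have "\<dots> = real (n ^ 2 + 1) * exp (- (16 * real (card S) * ln n))" by simp
    also have "\<dots> \<le> real (n ^ 3) * exp (- (16 * real (card S) * ln n))"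
    proof (intro mult_right_mono of_nat_mono)
      have "2 * n ^ 2 \<le> n * n ^ 2" using n by (intro mult_le_mono1)
      moreover have "1 \<le> n ^ 2" using n by simp
      moreover have "n * n ^ 2 = n ^ 3" by (simp add: numeral_eq_Suc)
      ultimately show "n ^ 2 + 1 \<le> n ^ 3" by linarith
    qed simp
    also have "real (n ^ 3) = exp (3 * ln n)"
      using n exp_of_nat_mult[of 3 "ln n"] by simp
    also have "\<dots> * exp (- (16 * real (card S) * ln n)) = exp (3 * ln n - 16 * real (card S) * ln n)"
      by (simp flip: exp_add)
    also have "\<dots> \<le> exp (card S * (- (13 * ln n)))"
    proof -
      have "3 * ln n * 1 \<le> 3 * ln n * card S" using lnn c1 by (intro mult_left_mono) auto
      then show ?thesis by (simp add: algebra_simps)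
    qed
    also have "\<dots> = exp (- (13 * ln n)) ^ card S" by (rule exp_of_nat_mult)
    finally show "(\<Sum>s\<le>n^2. \<Sum>W\<in>?C S s. (1 - p) ^ card (offdiag_edges W)) \<le> exp (- (13 * ln n)) ^ card S" .
  qed
  also have "\<dots> = (1 + exp (- (13 * ln n))) ^ n - 1"
    using sum_Pow_power_card[of ?V "exp (- (13 * ln n))"] by (simp add: sum_diff)
  also have "(1 + exp (- (13 * ln n))) ^ n \<le> exp (exp (- (13 * ln n))) ^ n"
    by (intro power_mono exp_ge_add_one_self) (simp add: add_nonneg_nonneg)
  also have "exp (exp (- (13 * ln n))) ^ n = exp (n * exp (- (13 * ln n)))"
    by (simp add: exp_of_nat_mult)
  finally show ?thesis by simp
qed

section \<open>Combining the lower and the upper bound\<close>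

lemma unit_distance_graph_mono:
  assumes "unit_distance_graph d E" "d \<le> d'"
  shows "unit_distance_graph d' E"
proof -
  obtain u where u: "\<And>i j. {i, j} \<in> E \<Longrightarrow> sqrt (\<Sum>k<d. (u i k - u j k)\<^sup>2) = 1"
    using assms(1) unfolding unit_distance_graph_def by blast
  define u' where "u' i k = (if k < d then u i k else 0)" for i k :: nat
  have "(\<Sum>k<d'. (u' i k - u' j k)\<^sup>2) = (\<Sum>k<d. (u i k - u j k)\<^sup>2)" for i j
    using assms(2) by (intro sum.mono_neutral_cong_right) (auto simp: u'_def)
  then show ?thesis
    unfolding unit_distance_graph_def using u by (intro exI[of _ u']) simp
qed

lemma prob_min_ud_dim_bounds:
  fixes n :: nat and p :: real
  defines "x \<equiv> n * ln (1 / (1 - p)) / ln n"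
  assumes n: "n \<ge> 2" "256 * ln n \<le> n powr (1/100)"
    and p: "n powr (-(99/100)) \<le> p" "p \<le> 1 - 1 / n"
  shows "1 - (exp (n * exp (- (13 * ln n))) - 1)
      - n * exp (- (200 * (n powr (1/100) / ln n) * exp (- (ln n / 200))))
    \<le> gnp_prob n p (\<lambda>E. 1/128 * x \<le> real (min_ud_dim E) \<and> real (min_ud_dim E) \<le> 400 * x)"
proof -
  define L where "L = - ln (1 - p)"
  have npos: "real n > 0" and lnn: "ln n > 0" using n(1) by auto
  have p01: "0 < p" "p < 1" using p npos by (smt (verit) powr_gt_zero divide_pos_pos)+
  have x: "x = n * L / ln n" using p01 by (simp add: x_def L_def ln_div)
  have Lp: "p \<le> L" using ln_add_one_self_le_self2[of "- p"] p01 by (simp add: L_def)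
  have "1 / n \<le> 1 - p" using p(2) by simp
  then have "ln (1 / n) \<le> ln (1 - p)" using p01 npos by (subst ln_le_cancel_iff) auto
  then have Ln: "L \<le> ln n" using npos by (simp add: L_def ln_div)
  \<comment> \<open>The lower bound on \<open>p\<close> forces x to grow at least like n^(1/100) /
    ln n, so that roundings and the additive 2 in the rank are negligible.\<close>
  have "n powr (1/100) = n * n powr (-(99/100))"
    using npos by (subst powr_mult_base) simp_all
  also have "\<dots> \<le> n * L" using p(1) Lp by (intro mult_left_mono) auto
  finally have xge: "n powr (1/100) / ln n \<le> x" unfolding x using lnn by (intro divide_right_mono) auto
  moreover have "256 \<le> n powr (1/100) / ln n" using n(2) lnn by (simp add: field_simps)
  ultimately have x256: "256 \<le> x" by linarith
  define d where "d = nat \<lfloor>x / 128\<rfloor>"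
  define m where "m = nat \<lfloor>400 * x\<rfloor>"
  have d: "real d \<le> x / 128" "x / 128 < real d + 1" and m: "real m \<le> 400 * x" "400 * x < real m + 1"
    using x256 unfolding d_def m_def by linarith+
  have m200: "200 * x \<le> m" using m(2) x256 by linarith
  then have mpos: "m > 0" using x256 by linarith
  have "gnp_prob n p (unit_distance_graph d) \<le> exp (n * exp (- (13 * ln n))) - 1"
  proof (rule prob_unit_distance_graph_le[OF n(1) p01])
    \<comment> \<open>From \<open>x \<ge> 256\<close>: d + 2 \<le> x / 128 + 2 \<le> x / 64.\<close>
    have "64 * (real (d + 2) * ln n) \<le> 64 * (x / 64 * ln n)"
      using d(1) x256 lnn by (intro mult_left_mono mult_right_mono) auto
    also have "\<dots> = n * (- ln (1 - p))" using lnn by (simp add: x L_def)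
    finally show "64 * (real (d + 2) * ln n) \<le> n * (- ln (1 - p))" .
    show "- ln (1 - p) \<le> ln n" using Ln by (simp add: L_def)
  qed
  moreover have "gnp_prob n p (\<lambda>E. \<not> colorable n m E)
    \<le> n * exp (- (200 * (n powr (1/100) / ln n) * exp (- (ln n / 200))))"
  proof -
    \<comment> \<open>Since \<open>m \<ge> 200 * x\<close>, the quantity (1 - p)^(n / m) is at least
      n^(-1/200). Multiplied by m it is still at least 200 n^(1/200) / ln n, which outweighs the
      factor n from the union over vertices.\<close>
    have "L * n = x * ln n" using lnn by (simp add: x)
    moreover have "200 * x * ln n \<le> m * ln n" using m200 lnn by (intro mult_right_mono) auto
    ultimately have "L * n \<le> m * (ln n / 200)" by simp
    then have "L * n / m \<le> ln n / 200" using mpos by (simp add: pos_divide_le_eq mult.commute)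
    then have e: "exp (- (ln n / 200)) \<le> exp (ln (1 - p) * (n / m))" by (simp add: L_def)
    have "200 * (n powr (1/100) / ln n) \<le> m" using xge m200 by linarith
    then have "200 * (n powr (1/100) / ln n) * exp (- (ln n / 200)) \<le> m * exp (ln (1 - p) * (n / m))"
      using e by (intro mult_mono) auto
    moreover have "gnp_prob n p (\<lambda>E. \<not> colorable n m E) \<le> n * exp (- (m * exp (ln (1 - p) * (n / m))))"
      using p01 mpos by (intro prob_not_colorable) auto
    ultimately show ?thesis
      by (elim order_trans) (intro mult_left_mono, auto)
  qed
  moreover have "1 - gnp_prob n p (unit_distance_graph d) - gnp_prob n p (\<lambda>E. \<not> colorable n m E)
    \<le> gnp_prob n p (\<lambda>E. 1/128 * x \<le> real (min_ud_dim E) \<and> real (min_ud_dim E) \<le> 400 * x)"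
  proof -
    \<comment> \<open>The bounds can fail only if the graph is representable in dimension
      \<open>d\<close> or is not \<open>m\<close>-colourable.\<close>
    have "1 - gnp_prob n p (unit_distance_graph d) - gnp_prob n p (\<lambda>E. \<not> colorable n m E) =
      rsub_expect p (all_pairs n) (\<lambda>E. 1 - of_bool (unit_distance_graph d E) - of_bool (\<not> colorable n m E))"
      unfolding gnp_prob_eq_expect rsub_expect_diff by simp
    also have "\<dots> \<le> rsub_expect p (all_pairs n)
        (\<lambda>E. of_bool (1/128 * x \<le> real (min_ud_dim E) \<and> real (min_ud_dim E) \<le> 400 * x))"
    proof (rule rsub_expect_mono)
      fix E assume E: "E \<subseteq> all_pairs n"
      have "1/128 * x \<le> real (min_ud_dim E)" if "\<not> unit_distance_graph d E"
      proof -
        have "\<not> min_ud_dim E \<le> d"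
          using unit_distance_graph_mono[OF unit_distance_graph_min_ud_dim[OF E]] that by blast
        then show ?thesis using d(2) by linarith
      qed
      moreover have "real (min_ud_dim E) \<le> 400 * x" if "colorable n m E"
      proof -
        have "min_ud_dim E \<le> m"
          unfolding min_ud_dim_def using colorable_imp_unit_distance_graph[OF that E] by (rule Least_le)
        then show ?thesis using m(1) by linarith
      qed
      ultimately show "1 - of_bool (unit_distance_graph d E) - of_bool (\<not> colorable n m E)
        \<le> (of_bool (1/128 * x \<le> real (min_ud_dim E) \<and> real (min_ud_dim E) \<le> 400 * x) :: real)"
        by (cases "unit_distance_graph d E"; cases "colorable n m E") auto
    qed (use p01 in auto)
    finally show ?thesis unfolding gnp_prob_eq_expect .
  qed
  ultimately show ?thesis by linarith
qed

theorem theorem4p2: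
  shows "\<exists>c C :: real. 0 < c \<and> c < C \<and>
    (\<forall>p :: nat \<Rightarrow> real.
      (\<forall>\<^sub>F n in sequentially. real n powr (-(99/100)) \<le> p n \<and> p n \<le> 1 - 1 / real n) \<longrightarrow>
      ((\<lambda>n. gnp_prob n (p n) (\<lambda>E.
          c * (real n * ln (1 / (1 - p n)) / ln (real n)) \<le> real (min_ud_dim E) \<and>
          real (min_ud_dim E) \<le> C * (real n * ln (1 / (1 - p n)) / ln (real n))))
        \<longlonglongrightarrow> 1))"
proof (rule exI[of _ "1/128"], rule exI[of _ 400], intro conjI allI impI)
  fix p :: "nat \<Rightarrow> real"
  assume p: "\<forall>\<^sub>F n in sequentially. real n powr (-(99/100)) \<le> p n \<and> p n \<le> 1 - 1 / real n"
  let ?good = "\<lambda>n. gnp_prob n (p n) (\<lambda>E.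
      1/128 * (real n * ln (1 / (1 - p n)) / ln (real n)) \<le> real (min_ud_dim E) \<and>
      real (min_ud_dim E) \<le> 400 * (real n * ln (1 / (1 - p n)) / ln (real n)))"
  let ?low = "\<lambda>n :: nat. 1 - (exp (n * exp (- (13 * ln n))) - 1)
      - n * exp (- (200 * (n powr (1/100) / ln n) * exp (- (ln n / 200))))"
  have large: "\<forall>\<^sub>F n :: nat in sequentially. n \<ge> 2 \<and> 256 * ln n \<le> n powr (1/100)"
    by (intro eventually_conj eventually_ge_at_top) real_asymp
  show "?good \<longlonglongrightarrow> 1"
  proof (rule tendsto_sandwich)
    show "\<forall>\<^sub>F n in sequentially. ?low n \<le> ?good n"
      using p large by eventually_elim (intro prob_min_ud_dim_bounds, auto)
    show "\<forall>\<^sub>F n in sequentially. ?good n \<le> 1"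
      using p large
    proof eventually_elim
      case (elim n)
      have "0 < real n powr (-(99/100))" "0 < 1 / real n" using elim by auto
      then have "0 \<le> p n" "p n \<le> 1" using elim by linarith+
      then have "?good n \<le> rsub_expect (p n) (all_pairs n) (\<lambda>_. 1)"
        unfolding gnp_prob_eq_expect by (intro rsub_expect_mono) auto
      then show ?case by simp
    qed
    \<comment> \<open>The first error is exp (n^(-12)) - 1, the second n exp (- 200 n^(1/200) / ln
      n); both tend to 0.\<close>
    show "?low \<longlonglongrightarrow> 1" by real_asymp
  qed simp
qed simp_all

end
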